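(* For any integers $d\ge 2$ and $k\ge 1$ there exists $n_0$ such that for all $n\ge n_0$, \[M_k(d,n)\le T\big(n,A_k(d)\big)\le\left(1-\frac1{A_k(d)}\right)\frac{n^2}{2}.\] Moreover, there is a constant $c=c(k,d)>0$ such that this remains valid if in the definition of $M_k(d,n)$ the intervals $[t_i,t_i+1]$ are replaced by the intervals $[t_i,t_i+cn^{1/d}]$.
   Context: A set $P\subseteq\mathbb{R}^d$ is separated if $\|p_1-p_2\|\ge1$ for all distinct $p_1,p_2\in P$. $M_k(d,n)$ is the largest $M$ for which there exist a separated set $S\subseteq\mathbb{R}^d$ of $n$ points and reals $1\le t_1\le\dots\le t_k$ such that at least $M$ pairs $\{p_1,p_2\}\subseteq S$ satisfy $\|p_1-p_2\|\in\bigcup_{i=1}^k[t_i,t_i+1]$. $T(n,s)$ is the number of edges of the balanced complete $s$-partite graph on $n$ vertices. For $\varepsilon>0$, a separated set $P$ is an $\varepsilon$-nearly $k$-distance set (with distances $1\le t_1<\dots<t_k$) if $\|p_1-p_2\|\in\bigcup_{i=1}^k[t_i,t_i+\varepsilon]$ for all distinct $p_1,p_2\in P$. A $j$-plane is an affine subspace of dimension $j$; the angle between a vector $v$ and a plane $\Lambda$ is the infimum of the angles between $v$ and vectors $w\in\Lambda-\Lambda$. A set $P$ is $(p,j,\alpha)$-flat (for $p\in P$) if there is a $j$-plane $\Lambda_p$ such that every vector $p-q$, $q\in P$, makes angle at most $\alpha$ with $\Lambda_p$ (by convention every $P$ is $(p,0,\alpha)$-flat). $P$ is almost $(j,\alpha)$-flat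 if $P$ is $(p,j,\alpha)$-flat for all but at most two points $p\in P$. For $0\le j\le d'$, $A_k(d',j)$ is the largest $N$ such that for every $\varepsilon,\alpha>0$ there exists an almost $(j,\alpha)$-flat $\varepsilon$-nearly $k$-distance set in $\mathbb{R}^{d'}$ of cardinality $N$; and $A_k(d):=A_k(d,d-1)$. *)

theory Defs
  imports "HOL-Analysis.Analysis"
begin

definition separated :: "'a::euclidean_space set \<Rightarrow> bool" where
  "separated P \<longleftrightarrow> (\<forall>p1\<in>P. \<forall>p2\<in>P. p1 \<noteq> p2 \<longrightarrow> dist p1 p2 \<ge> 1)"

definition dist_params :: "nat \<Rightarrow> (nat \<Rightarrow> real) \<Rightarrow> bool" where
  "dist_params k t \<longleftrightarrow> 1 \<le> t 0 \<and> (\<forall>i. Suc i < k \<longrightarrow> t i \<le> t (Suc i))"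

definition good_pairs :: "nat \<Rightarrow> (nat \<Rightarrow> real) \<Rightarrow> real \<Rightarrow> 'a::euclidean_space set \<Rightarrow> nat" where
  "good_pairs k t w S = card {{p1, p2} | p1 p2. p1 \<in> S \<and> p2 \<in> S \<and> p1 \<noteq> p2 \<and>
      (\<exists>i<k. t i \<le> dist p1 p2 \<and> dist p1 p2 \<le> t i + w)}"

text \<open>M_k(d,n) with intervals of width w (the paper's M_k(d,n) is width 1);
  the dimension d is DIM('a).\<close>
definition Mw :: "'a::euclidean_space itself \<Rightarrow> nat \<Rightarrow> nat \<Rightarrow> real \<Rightarrow> nat" where
  "Mw _ k n w = (GREATEST M. \<exists>(S::'a set) t. separated S \<and> finite S \<and> card S = n \<and>
       dist_params k t \<and> M \<le> good_pairs k t w S)"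

abbreviation M :: "'a::euclidean_space itself \<Rightarrow> nat \<Rightarrow> nat \<Rightarrow> nat" where
  "M A k n \<equiv> Mw A k n 1"

text \<open>T(n,s): edges of the balanced complete s-partite graph on n vertices;
  part i (i < s) has size n div s + (1 if i < n mod s).\<close>
definition part_size :: "nat \<Rightarrow> nat \<Rightarrow> nat \<Rightarrow> nat" where
  "part_size n s i = n div s + (if i < n mod s then 1 else 0)"

definition turan :: "nat \<Rightarrow> nat \<Rightarrow> nat" where
  "turan n s = (\<Sum>j<s. \<Sum>i<j. part_size n s i * part_size n s j)"

definition nearly_k_distance :: "nat \<Rightarrow> real \<Rightarrow> 'a::euclidean_space set \<Rightarrow> bool" where
  "nearly_k_distance k \<epsilon> P \<longleftrightarrow> separated P \<and>
     (\<exists>t::nat \<Rightarrow> real. 1 \<le> t 0 \<and> (\<forall>i. Suc i < k \<longrightarrow> t i < t (Suc i)) \<and>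
        (\<forall>p1\<in>P. \<forall>p2\<in>P. p1 \<noteq> p2 \<longrightarrow>
            (\<exists>i<k. t i \<le> dist p1 p2 \<and> dist p1 p2 \<le> t i + \<epsilon>)))"

definition vec_angle :: "'a::euclidean_space \<Rightarrow> 'a \<Rightarrow> real" where
  "vec_angle u v = arccos (inner u v / (norm u * norm v))"

definition plane_angle :: "'a::euclidean_space \<Rightarrow> 'a set \<Rightarrow> real" where
  "plane_angle v L = Inf {vec_angle v w | w. w \<in> {x - y | x y. x \<in> L \<and> y \<in> L} \<and> w \<noteq> 0}"

definition is_plane :: "nat \<Rightarrow> 'a::euclidean_space set \<Rightarrow> bool" where
  "is_plane j L \<longleftrightarrow> affine L \<and> L \<noteq> {} \<and> aff_dim L = int j"

text \<open>(p,j,alpha)-flatness; every set is (p,0,alpha)-flat by convention.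
  The zero vector p - p is not considered.\<close>
definition flat_at :: "'a::euclidean_space set \<Rightarrow> 'a \<Rightarrow> nat \<Rightarrow> real \<Rightarrow> bool" where
  "flat_at P p j \<alpha> \<longleftrightarrow> j = 0 \<or>
     (\<exists>L. is_plane j L \<and> (\<forall>q\<in>P. q \<noteq> p \<longrightarrow> plane_angle (p - q) L \<le> \<alpha>))"

definition almost_flat :: "nat \<Rightarrow> real \<Rightarrow> 'a::euclidean_space set \<Rightarrow> bool" where
  "almost_flat j \<alpha> P \<longleftrightarrow> card {p \<in> P. \<not> flat_at P p j \<alpha>} \<le> 2"

text \<open>A_k(d',j) with d' = DIM('a), and A_k(d) = A_k(d,d-1).\<close>
definition A_gen :: "'a::euclidean_space itself \<Rightarrow> nat \<Rightarrow> nat \<Rightarrow> nat" where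
  "A_gen _ k j = (GREATEST N. \<forall>\<epsilon>>0. \<forall>\<alpha>>0. \<exists>P::'a set. finite P \<and> card P = N \<and>
       almost_flat j \<alpha> P \<and> nearly_k_distance k \<epsilon> P)"

definition A :: "'a::euclidean_space itself \<Rightarrow> nat \<Rightarrow> nat" where
  "A T k = A_gen T k (DIM('a) - 1)"

end

theory Submission
  imports Defs
begin

text \<open>Suppose that the graph of good pairs has more than \<open>turan n a\<close> edges, where \<open>a = A_k(d)\<close>, and
  choose \<open>\<epsilon>\<close>, \<open>\<alpha>\<close> for which no almost flat \<open>\<epsilon>\<close>-nearly \<open>k\<close>-distance set of \<open>a + 1\<close> points exists.
  By Erdos's strengthening of Turan's theorem some edge \<open>pq\<close> lies in at least \<open>\<delta> n^(a - 1)\<close> cliques of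
  \<open>a + 1\<close> vertices.  A vertex \<open>v\<close> of a clique can, except for few cliques, be replaced by some \<open>v'\<close>
  without changing the intervals of the distances to the other vertices, where \<open>|v - v'|\<close> is large
  compared with the interval width \<open>w = c n^(1/d)\<close> but small compared with all distances from \<open>v\<close>.
  Then all edges at \<open>v\<close> are almost orthogonal to \<open>v - v'\<close>, so the clique is flat at \<open>v\<close>, and
  rescaling by \<open>w / \<epsilon>\<close> gives a forbidden set in which only \<open>p\<close> and \<open>q\<close> are exceptional.

  This needs \<open>t 0\<close> to be large compared with \<open>w\<close>.  Otherwise drop all short edges, which are at most a
  small multiple of \<open>n^2\<close>.  There still are \<open>\<delta> n^a\<close> cliques on \<open>a\<close> vertices, one of them is flat at
  every vertex, and it avoids the distance \<open>t 0\<close>.  Adding the replacement \<open>v'\<close> of a single vertex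
  \<open>v\<close> costs one new distance \<open>|v - v'|\<close> and the two exceptional points \<open>v\<close>, \<open>v'\<close>.\<close>

section \<open>Turan numbers and Turan's theorem\<close>

text \<open>The vertices are dealt to the parts in cyclic order, so vertex number \<open>n\<close>
  joins part \<open>n mod s\<close>. All recursions in \<open>n\<close> rest on this.\<close>

lemma part_size_Suc:
  assumes "s > 0" "i < s"
  shows "part_size (Suc n) s i = part_size n s i + (if i = n mod s then 1 else 0)"
proof (cases "Suc n mod s = 0")
  case True
  then have "Suc n div s = Suc (n div s)" "n mod s = s - 1"
    using assms by (auto simp: div_Suc mod_Suc split: if_splits)
  then show ?thesis using assms True by (auto simp: part_size_def)
next
  case False
  then have "Suc n div s = n div s" "Suc n mod s = Suc (n mod s)"
    using assms by (auto simp: div_Suc mod_Suc split: if_splits)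
  then show ?thesis by (auto simp: part_size_def)
qed

lemma sum_part_size:
  assumes "s > 0"
  shows "(\<Sum>i<s. part_size n s i) = n"
proof (induction n)
  case 0
  then show ?case by (simp add: part_size_def)
next
  case (Suc n)
  have "(\<Sum>i<s. part_size (Suc n) s i) = (\<Sum>i<s. part_size n s i + (if i = n mod s then 1 else 0))"
    using part_size_Suc[OF assms] by (intro sum.cong) auto
  also have "\<dots> = Suc n" using Suc assms by (simp add: sum.distrib)
  finally show ?case .
qed

lemma square_sum_offdiag:
  fixes f :: "nat \<Rightarrow> real"
  shows "(\<Sum>i<s. f i)^2 = (\<Sum>i<s. (f i)^2) + 2 * (\<Sum>j<s. \<Sum>i<j. f i * f j)"
proof (induction s)
  case (Suc s)
  then show ?case by (simp add: power2_sum sum_distrib_right)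
qed simp

text \<open>Pairs inside a part are the ones that are missing. In this form both the recursion in
  \<open>n\<close> and the Cauchy-Schwarz bound are short computations.\<close>

lemma turan_squares:
  assumes "s > 0"
  shows "2 * real (turan n s) = (real n)^2 - (\<Sum>i<s. (real (part_size n s i))^2)"
proof -
  have "real n = (\<Sum>i<s. real (part_size n s i))"
    using sum_part_size[OF assms, of n] by (metis of_nat_sum)
  then show ?thesis using square_sum_offdiag[of "\<lambda>i. real (part_size n s i)" s]
    by (simp add: turan_def)
qed

text \<open>The new vertex is joined to all old ones except the \<open>n div s\<close> vertices
  already in its part. The additive form avoids truncated subtraction.\<close>

lemma turan_Suc:
  assumes "s > 0"
  shows "turan (Suc n) s + n div s = turan n s + n"
proof -
  have "(\<Sum>i<s. (real (part_size (Suc n) s i))^2) =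
     (\<Sum>i<s. (real (part_size n s i))^2 + (if i = n mod s then 2 * real (part_size n s i) + 1 else 0))"
    using part_size_Suc[OF assms] by (intro sum.cong) (auto simp: power2_eq_square algebra_simps)
  also have "\<dots> = (\<Sum>i<s. (real (part_size n s i))^2) + (2 * real (n div s) + 1)"
    using assms by (simp add: sum.distrib part_size_def)
  finally have "2 * real (turan (Suc n) s) = 2 * real (turan n s) + 2 * (real n - real (n div s))"
    using turan_squares[OF assms, of n] turan_squares[OF assms, of "Suc n"]
    by (simp add: power2_eq_square algebra_simps)
  then have "real (turan (Suc n) s + n div s) = real (turan n s + n)" by simp
  then show ?thesis by linarith
qed

lemma turan_0: "turan 0 s = 0"
  by (simp add: turan_def part_size_def)

text \<open>Cauchy-Schwarz for the part sizes, which add up to \<open>n\<close>.\<close>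

lemma turan_upper:
  assumes "s > 0"
  shows "real (turan n s) \<le> (1 - 1 / real s) * (real n)^2 / 2"
proof -
  have "(real n)^2 = (\<Sum>i<s. real (part_size n s i))^2"
    using sum_part_size[OF assms, of n] by (metis of_nat_sum)
  also have "\<dots> \<le> real s * (\<Sum>i<s. (real (part_size n s i))^2)"
    using sum_squared_le_sum_of_squares[of "\<lambda>i. real (part_size n s i)" "{..<s}"] by (simp add: mult.commute)
  finally have "(real n)^2 / real s \<le> (\<Sum>i<s. (real (part_size n s i))^2)"
    using assms by (simp add: field_simps)
  then show ?thesis using turan_squares[OF assms, of n] by (simp add: algebra_simps)
qed

lemma turan_lower:
  assumes "s > 0"
  shows "real (turan n s) \<ge> (1 - 1 / real s) * (real n)^2 / 2 - real n / 2"
proof -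
  \<comment> \<open>The form with \<open>n (n - 1)\<close> is the one that induction preserves,
    since a step adds \<open>n - n div s\<close>, which is at least
    \<open>n - n / s\<close>.\<close>
  have *: "2 * real (turan n s) \<ge> (1 - 1 / real s) * real n * (real n - 1)"
  proof (induction n)
    case (Suc n)
    have "real (n div s) \<le> real n / real s"
      by (metis of_nat_div_le_of_nat)
    moreover have "real (turan (Suc n) s) + real (n div s) = real (turan n s) + real n"
      using turan_Suc[OF assms, of n] by (metis of_nat_add)
    ultimately have "2 * real (turan (Suc n) s) \<ge> 2 * real (turan n s) + 2 * (real n - real n / real s)"
      by argo
    moreover have "(1 - 1 / real s) * real (Suc n) * (real (Suc n) - 1)
        = (1 - 1 / real s) * real n * (real n - 1) + 2 * (real n - real n / real s)"
      using assms by (simp add: field_simps)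
    ultimately show ?case using Suc by linarith
  qed (simp add: turan_0)
  have "(1 - 1 / real s) * real n \<le> real n"
    using assms by (simp add: mult_left_le_one_le)
  moreover have "(1 - 1 / real s) * real n * (real n - 1)
      = (1 - 1 / real s) * (real n)^2 - (1 - 1 / real s) * real n"
    by (simp add: power2_eq_square right_diff_distrib)
  ultimately show ?thesis using * by argo
qed

text \<open>The main terms of the two bounds differ by \<open>n^2 / (2 r (r + 1))\<close>, and the
  assumption on \<open>n\<close> keeps the linear error at no more than half of this. The gap pays
  for the short edges that are dropped later.\<close>

lemma turan_gap:
  assumes "r > 0" and "n \<ge> 2 * r * (r + 1)"
  shows "real (turan n r) + (real n)^2 / (4 * real r * real (r + 1)) \<le> real (turan n (Suc r))"
proof -
  have "real n / 2 \<le> real n * real n / (4 * real r * real (r + 1))"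
  proof -
    have "real (2 * r * (r + 1)) \<le> real n" using assms(2) by (simp only: of_nat_le_iff)
    then have "real n * (2 * real r * (real r + 1)) \<le> real n * real n"
      by (intro mult_left_mono) (simp_all add: algebra_simps)
    then have "real n * (2 * real r * (real r + 1)) / (4 * real r * real (r + 1))
        \<le> real n * real n / (4 * real r * real (r + 1))"
      by (intro divide_right_mono) auto
    moreover have "real n * (2 * real r * (real r + 1)) / (4 * real r * real (r + 1)) = real n / 2"
    proof -
      have "real r * (real r + 1) \<noteq> 0" using assms(1) by (simp add: add_eq_0_iff)
      then show ?thesis by (simp add: field_simps)
    qed
    ultimately show ?thesis by argo
  qed
  moreover have "(1 - 1 / real (Suc r)) * (real n)^2 / 2
      = (1 - 1 / real r) * (real n)^2 / 2 + 2 * (real n * real n / (4 * real r * real (r + 1)))"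
  proof -
    have "1 - 1 / real (Suc r) = 1 - 1 / real r + 1 / (real r * real (r + 1))"
      using assms(1) by (simp add: divide_simps add_eq_0_iff) (simp add: algebra_simps)
    then show ?thesis by (simp only: power2_eq_square distrib_right add_divide_distrib) simp
  qed
  ultimately show ?thesis
    using turan_upper[OF assms(1), of n] turan_lower[OF zero_less_Suc, of r n]
    unfolding power2_eq_square by argo
qed

section \<open>Cliques and edge counts in graphs given by sets of edges\<close>

definition clique :: "'v set set \<Rightarrow> 'v set \<Rightarrow> bool" where
  "clique E C \<longleftrightarrow> (\<forall>x\<in>C. \<forall>y\<in>C. x \<noteq> y \<longrightarrow> {x, y} \<in> E)"

definition edges_in :: "'v set set \<Rightarrow> 'v set \<Rightarrow> 'v set set" where
  "edges_in E W = {e \<in> E. e \<subseteq> W}"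

definition nbrs :: "'v set set \<Rightarrow> 'v set \<Rightarrow> 'v \<Rightarrow> 'v set" where
  "nbrs E W v = {u \<in> W. {u, v} \<in> E}"

definition simple_edges :: "'v set set \<Rightarrow> bool" where
  "simple_edges E \<longleftrightarrow> (\<forall>e\<in>E. card e = 2)"

lemma no_loop: "simple_edges E \<Longrightarrow> {x, x} \<notin> E"
  by (auto simp: simple_edges_def)

lemma clique_subset: "clique E Q \<Longrightarrow> C \<subseteq> Q \<Longrightarrow> clique E C"
  by (auto simp: clique_def)

lemma card_edges_in_delete:
  assumes "simple_edges E" "finite W" "v \<in> W"
  shows "card (edges_in E W) = card (edges_in E (W - {v})) + card (nbrs E W v)"
proof -
  have fin: "finite (edges_in E W)"
    by (rule finite_subset[of _ "Pow W"]) (auto simp: edges_in_def assms)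
  have split: "edges_in E W = edges_in E (W - {v}) \<union> (\<lambda>u. {u, v}) ` nbrs E W v"
  proof (intro set_eqI iffI)
    fix e assume e: "e \<in> edges_in E W"
    show "e \<in> edges_in E (W - {v}) \<union> (\<lambda>u. {u, v}) ` nbrs E W v"
    proof (cases "v \<in> e")
      case True
      from e have "card e = 2" using assms(1) by (auto simp: edges_in_def simple_edges_def)
      then obtain x y where xy: "e = {x, y}" by (auto simp: card_2_iff)
      with True obtain u where "e = {u, v}" by auto
      then show ?thesis using e by (auto simp: edges_in_def nbrs_def)
    next
      case False
      then show ?thesis using e by (auto simp: edges_in_def)
    qed
  next
    fix e assume "e \<in> edges_in E (W - {v}) \<union> (\<lambda>u. {u, v}) ` nbrs E W v"
    then show "e \<in> edges_in E W" using assms(3) by (auto simp: edges_in_def nbrs_def)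
  qed
  have "inj_on (\<lambda>u. {u, v}) (nbrs E W v)" by (auto simp: inj_on_def doubleton_eq_iff)
  then have "card ((\<lambda>u. {u, v}) ` nbrs E W v) = card (nbrs E W v)" by (rule card_image)
  moreover have "edges_in E (W - {v}) \<inter> (\<lambda>u. {u, v}) ` nbrs E W v = {}"
    by (auto simp: edges_in_def)
  moreover have "finite (edges_in E (W - {v}))" "finite ((\<lambda>u. {u, v}) ` nbrs E W v)"
    using fin split by (metis finite_Un)+
  ultimately show ?thesis using split by (simp add: card_Un_disjoint)
qed

lemma card_edges_in_le:
  assumes "simple_edges E" "finite W"
  shows "real (card (edges_in E W)) \<le> (real (card W))^2"
proof -
  have "edges_in E W \<subseteq> (\<lambda>(x, y). {x, y}) ` (W \<times> W)"
  proof
    fix e assume e: "e \<in> edges_in E W"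
    then have "card e = 2" using assms(1) by (auto simp: edges_in_def simple_edges_def)
    then obtain x y where "e = {x, y}" by (auto simp: card_2_iff)
    then show "e \<in> (\<lambda>(x, y). {x, y}) ` (W \<times> W)" using e by (auto simp: edges_in_def)
  qed
  then have "card (edges_in E W) \<le> card (W \<times> W)"
    using assms(2) by (metis (no_types, lifting) card_image_le card_mono finite_SigmaI finite_imageI le_trans)
  then show ?thesis by (simp add: card_cartesian_product power2_eq_square flip: of_nat_mult)
qed

text \<open>Induction on the number \<open>n + 1\<close> of vertices. If there is no such clique,
  deleting a vertex shows that each vertex has at most \<open>n div r\<close> non-neighbours, itself
  included. The non-neighbourhoods of a maximum clique cover \<open>V\<close>, but have at most
  \<open>r * (n div r) \<le> n\<close> elements in all.\<close>

lemma turan_theorem: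
  assumes "simple_edges E" "finite V" "r > 0" "card (edges_in E V) > turan (card V) r"
  shows "\<exists>C\<subseteq>V. card C = Suc r \<and> clique E C"
  using assms(2,4)
proof (induction "card V" arbitrary: V)
  case 0
  then have "V = {}" by simp
  then have "edges_in E V \<subseteq> {}" using assms(1) by (auto simp: edges_in_def simple_edges_def)
  then show ?case using 0 by simp
next
  case (Suc n)
  show ?case
  proof (rule ccontr)
    assume no: "\<not> ?case"
    define Qs where "Qs = {Q. Q \<subseteq> V \<and> clique E Q}"
    have "finite Qs" "{} \<in> Qs" using Suc by (auto simp: Qs_def clique_def)
    then have "Max (card ` Qs) \<in> card ` Qs" by (intro Max_in) auto
    then obtain Q where Q: "Q \<in> Qs" "\<And>Q'. Q' \<in> Qs \<Longrightarrow> card Q' \<le> card Q"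
      using \<open>finite Qs\<close> by (metis (no_types, lifting) Max_ge finite_imageI image_eqI imageE)
    have finQ: "finite Q" using Q Suc finite_subset by (auto simp: Qs_def)
    have Qr: "card Q \<le> r"
    proof (rule ccontr)
      assume "\<not> card Q \<le> r"
      then obtain C where "C \<subseteq> Q" "card C = Suc r"
        using obtain_subset_with_card_n[of "Suc r" Q] by auto
      then show False using no Q clique_subset[of E Q C] by (auto simp: Qs_def)
    qed
    have deg: "card (nbrs E V x) + n div r > n" if "x \<in> V" for x
    proof (rule ccontr)
      assume "\<not> card (nbrs E V x) + n div r > n"
      moreover have n: "n = card (V - {x})" using Suc that by (simp flip: Suc(2))
      moreover have "card (edges_in E V) > turan (Suc n) r" using Suc(2,4) by simp
      ultimately have "card (edges_in E (V - {x})) > turan n r"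
        using card_edges_in_delete[OF assms(1) Suc(3) that] turan_Suc[OF assms(3), of n] by linarith
      then have "\<exists>C\<subseteq>V - {x}. card C = Suc r \<and> clique E C"
        using Suc(1)[OF n] Suc(3) n by auto
      then show False using no by blast
    qed
    \<comment> \<open>A vertex adjacent to all of \<open>Q\<close> would extend this maximum
      clique.\<close>
    have "V \<subseteq> (\<Union>x\<in>Q. V - nbrs E V x)"
    proof
      fix y assume y: "y \<in> V"
      show "y \<in> (\<Union>x\<in>Q. V - nbrs E V x)"
      proof (rule ccontr)
        assume "y \<notin> (\<Union>x\<in>Q. V - nbrs E V x)"
        then have adj: "\<forall>x\<in>Q. {y, x} \<in> E" using y by (auto simp: nbrs_def)
        then have "y \<notin> Q" using no_loop[OF assms(1)] by blast
        moreover have "insert y Q \<in> Qs" using adj y Q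
          by (auto simp: Qs_def clique_def insert_commute)
        ultimately show False using Q(2)[of "insert y Q"] finQ by simp
      qed
    qed
    then have "card V \<le> card (\<Union>x\<in>Q. V - nbrs E V x)"
      using Suc(3) finQ by (intro card_mono) auto
    also have "\<dots> \<le> (\<Sum>x\<in>Q. card (V - nbrs E V x))" using card_UN_le[OF finQ] .
    also have "\<dots> \<le> (\<Sum>x\<in>Q. n div r)"
    proof (intro sum_mono)
      fix x assume "x \<in> Q"
      then have "x \<in> V" using Q by (auto simp: Qs_def)
      have "card (V - nbrs E V x) = card V - card (nbrs E V x)"
        using Suc(3) by (intro card_Diff_subset) (auto simp: nbrs_def)
      then show "card (V - nbrs E V x) \<le> n div r" using deg[OF \<open>x \<in> V\<close>] Suc(2)
        by linarith
    qed
    also have "\<dots> \<le> r * (n div r)" using Qr by simp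
    also have "\<dots> \<le> n" by simp
    finally show False using Suc(2) by simp
  qed
qed

section \<open>Cliques sharing an edge\<close>

definition cliques :: "'v set set \<Rightarrow> 'v set \<Rightarrow> nat \<Rightarrow> 'v set set" where
  "cliques E W m = {C. C \<subseteq> W \<and> card C = m \<and> clique E C}"

lemma finite_cliques: "finite W \<Longrightarrow> finite (cliques E W m)"
  by (rule finite_subset[of _ "Pow W"]) (auto simp: cliques_def)

text \<open>A vertex subset of minimal size with edge excess at least
  \<open>1 + \<eta>/4 (|V|^2 - |W|^2)\<close> over the Turan number: the deletion of a vertex of low degree would keep
  the excess, and the excess itself prevents \<open>W\<close> from being small.\<close>

lemma dense_subgraph:
  assumes "simple_edges E" "finite V" "r > 0" "0 < \<eta>" "\<eta> \<le> (1::real)"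
    and "card (edges_in E V) > turan (card V) r"
  obtains W where "W \<subseteq> V" "card (edges_in E W) > turan (card W) r"
    "\<And>v. v \<in> W \<Longrightarrow> real (card (W - nbrs E W v)) \<le> 1 + (1 / r + \<eta> / 2) * card W"
    "\<eta> * (real (card V))^2 \<le> 8 * (real (card W))^2"
proof -
  define Q where "Q W \<longleftrightarrow> W \<subseteq> V \<and> real (card (edges_in E W)) \<ge>
     real (turan (card W) r) + 1 + \<eta> / 4 * ((real (card V))^2 - (real (card W))^2)" for W
  have "Q V" using assms(6) by (auto simp: Q_def)
  then obtain W where W: "Q W" "\<And>W'. Q W' \<Longrightarrow> card W \<le> card W'"
    using ex_has_least_nat[of Q V card] by blast
  have WV: "W \<subseteq> V" using W by (simp add: Q_def)
  have finW: "finite W" using WV assms(2) finite_subset by auto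
  have wv: "(real (card W))^2 \<le> (real (card V))^2"
    using WV assms(2) by (simp add: card_mono)
  have ew: "real (card (edges_in E W)) \<ge>
     real (turan (card W) r) + 1 + \<eta> / 4 * ((real (card V))^2 - (real (card W))^2)"
    using W by (simp add: Q_def)
  have nn: "0 \<le> \<eta> / 4 * ((real (card V))^2 - (real (card W))^2)" using wv assms(4) by simp
  have "card (edges_in E W) > turan (card W) r" using ew nn by linarith
  moreover have "\<eta> * (real (card V))^2 \<le> 8 * (real (card W))^2"
  proof -
    have "\<eta> / 4 * ((real (card V))^2 - (real (card W))^2) \<le> (real (card W))^2"
      using ew card_edges_in_le[OF assms(1) finW] by linarith
    moreover have "\<eta> / 4 * (real (card W))^2 \<le> 1 * (real (card W))^2"
      using assms(5) by (intro mult_right_mono) auto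
    ultimately show ?thesis by (simp add: algebra_simps)
  qed
  moreover have "real (card (W - nbrs E W v)) \<le> 1 + (1 / r + \<eta> / 2) * card W" if v: "v \<in> W" for v
  proof -
    obtain m where m: "card W = Suc m" using v finW by (metis card_Suc_Diff1)
    then have m': "card (W - {v}) = m" using v finW by simp
    have "\<not> Q (W - {v})" using W(2)[of "W - {v}"] m m' by auto
    then have "real (card (edges_in E (W - {v}))) <
        real (turan m r) + 1 + \<eta> / 4 * ((real (card V))^2 - (real m)^2)"
      using WV m' by (auto simp: Q_def)
    moreover have "real (card (edges_in E W)) = real (card (edges_in E (W - {v}))) + real (card (nbrs E W v))"
      using card_edges_in_delete[OF assms(1) finW v] by simp
    moreover have "real (turan (Suc m) r) + real (m div r) = real (turan m r) + real m"
      using turan_Suc[OF assms(3), of m] by (metis of_nat_add)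
    moreover have "\<eta> / 4 * ((real (card V))^2 - (real (Suc m))^2) =
        \<eta> / 4 * ((real (card V))^2 - (real m)^2) - \<eta> / 4 * (2 * real m + 1)"
      by (simp add: power2_eq_square algebra_simps add_divide_distrib)
    ultimately have deg: "real (card (nbrs E W v)) \<ge> real m - real (m div r) - \<eta> / 4 * (2 * real m + 1)"
      using ew[unfolded m] by argo
    have "card (W - nbrs E W v) = card W - card (nbrs E W v)"
      using finW by (intro card_Diff_subset) (auto simp: nbrs_def)
    moreover have "card (nbrs E W v) \<le> card W" using finW by (intro card_mono) (auto simp: nbrs_def)
    ultimately have "real (card (W - nbrs E W v)) = real (Suc m) - real (card (nbrs E W v))"
      using m by (simp add: of_nat_diff)
    also have "\<dots> \<le> 1 + real (m div r) + \<eta> / 4 * (2 * real m + 1)" using deg by simp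
    also have "\<dots> \<le> 1 + real (Suc m) / r + \<eta> / 4 * (2 * real (Suc m))"
    proof -
      have "real (m div r) \<le> real m / r" by (rule of_nat_div_le_of_nat)
      also have "\<dots> \<le> real (Suc m) / r" by (intro divide_right_mono) auto
      finally have "real (m div r) \<le> real (Suc m) / r" .
      moreover have "\<eta> / 4 * (2 * real m + 1) \<le> \<eta> / 4 * (2 * real (Suc m))"
        using assms(4) by (intro mult_left_mono) auto
      ultimately show ?thesis by linarith
    qed
    finally show ?thesis using m by (simp add: algebra_simps add_divide_distrib)
  qed
  ultimately show ?thesis using that WV by blast
qed

text \<open>Otherwise almost every \<open>y\<close> has a non-neighbour in \<open>C - I\<close> or two in \<open>I\<close>.  Counting
  non-neighbours in \<open>C - I\<close> twice gives total weight at least \<open>2\<close> per \<open>y\<close>, which is too much.\<close>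

lemma replaceable:
  fixes \<gamma> \<eta> :: real
  assumes "finite W" "clique E C" "C \<subseteq> W" "card C = Suc r" "I \<subseteq> C" "card I = 3"
    and nonnbr: "\<And>v. v \<in> W \<Longrightarrow> real (card (W - nbrs E W v)) \<le> (1 / r + \<eta>) * card W"
    and "6 * \<gamma> + (2 * real r - 1) * \<eta> < 1 / r"
  shows "\<exists>i\<in>I. real (card {y\<in>W. \<forall>x\<in>C-{i}. {y, x} \<in> E}) \<ge> \<gamma> * card W"
proof (rule ccontr)
  define R where "R i = {y\<in>W. \<forall>x\<in>C-{i}. {y, x} \<in> E}" for i
  \<comment> \<open>These weights sum to \<open>2 * r - 1\<close> over \<open>C\<close>. With at
    most \<open>(1 / r + \<eta>) * card W\<close> non-neighbours for each vertex of
    \<open>C\<close>, the total weight stays below \<open>2 * card W\<close> by a margin of about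
    \<open>card W / r\<close>.\<close>
  define c where "c j = (if j \<in> I then 1 else 2 :: nat)" for j
  define U where "U = W - (\<Union>i\<in>I. R i)"
  assume "\<not> ?thesis"
  then have small: "\<And>i. i \<in> I \<Longrightarrow> real (card (R i)) \<le> \<gamma> * card W" by (force simp: R_def)
  have finC: "finite C" using assms(1,3) finite_subset by auto
  have finI: "finite I" using assms(6) card_ge_0_finite by force
  have "r \<ge> 2" using card_mono[OF finC assms(5)] assms by auto
  have "C \<noteq> {}" using assms(4) by auto
  then have wpos: "card W > 0" using assms by (metis bot.extremum_uniqueI card_gt_0_iff)
  have "real (card (\<Union>i\<in>I. R i)) \<le> real (\<Sum>i\<in>I. card (R i))"
    using card_UN_le[OF finI] of_nat_le_iff by blast
  also have "\<dots> \<le> (\<Sum>i\<in>I. \<gamma> * card W)" using small by (simp add: sum_mono del: sum_constant)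
  finally have "real (card (\<Union>i\<in>I. R i)) \<le> 3 * \<gamma> * card W" using assms(6) by simp
  moreover have "(\<Union>i\<in>I. R i) \<subseteq> W" by (auto simp: R_def)
  then have "card U = card W - card (\<Union>i\<in>I. R i)" "card (\<Union>i\<in>I. R i) \<le> card W"
    unfolding U_def using assms(1) finite_subset by (auto intro!: card_Diff_subset card_mono)
  ultimately have U: "real (card U) \<ge> card W - 3 * \<gamma> * card W" by (simp add: of_nat_diff)
  have two: "2 \<le> (\<Sum>j\<in>{j\<in>C. y \<notin> nbrs E W j}. c j)" (is "_ \<le> sum c ?J") if y: "y \<in> U" for y
  proof -
    have finJ: "finite ?J" using finC by simp
    \<comment> \<open>As \<open>y\<close> cannot replace \<open>i\<close>, it has a non-neighbour in
      \<open>C\<close> other than \<open>i\<close>. If the first one found lies in \<open>I\<close>,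
      applying this to that vertex gives a second one.\<close>
    have ex: "\<exists>x\<in>?J. x \<noteq> i" if "i \<in> I" for i
      using y that by (auto simp: U_def R_def nbrs_def)
    obtain i where "i \<in> I" using assms(6) by fastforce
    then obtain x where x: "x \<in> ?J" using ex by blast
    show ?thesis
    proof (cases "x \<in> I")
      case False
      then show ?thesis using member_le_sum[of x ?J c] x finJ by (simp add: c_def)
    next
      case True
      then obtain x' where x': "x' \<in> ?J" "x' \<noteq> x" using ex by blast
      have "sum c {x, x'} \<le> sum c ?J" using x x' finJ by (intro sum_mono2) auto
      then show ?thesis using x' by (auto simp: c_def split: if_splits)
    qed
  qed
  have "(\<Sum>y\<in>U. 2) \<le> (\<Sum>y\<in>U. \<Sum>j\<in>{j\<in>C. y \<notin> nbrs E W j}. c j)"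
    by (intro sum_mono two)
  then have "2 * card U \<le> (\<Sum>y\<in>U. \<Sum>j\<in>{j\<in>C. y \<notin> nbrs E W j}. c j)" by simp
  also have "\<dots> \<le> (\<Sum>y\<in>W. \<Sum>j\<in>{j\<in>C. y \<notin> nbrs E W j}. c j)"
    using assms(1) by (intro sum_mono2) (auto simp: U_def)
  also have "\<dots> = (\<Sum>j\<in>C. \<Sum>y\<in>{y\<in>W. y \<notin> nbrs E W j}. c j)"
    using assms(1) finC by (intro sum.swap_restrict)
  also have "\<dots> = (\<Sum>j\<in>C. c j * card (W - nbrs E W j))"
    by (intro sum.cong) (auto simp: set_diff_eq)
  finally have "2 * real (card U) \<le> real (\<Sum>j\<in>C. c j * card (W - nbrs E W j))"
    by (metis (mono_tags, lifting) of_nat_le_iff of_nat_mult of_nat_numeral)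
  also have "\<dots> = (\<Sum>j\<in>C. real (c j) * real (card (W - nbrs E W j)))" by simp
  also have "\<dots> \<le> (\<Sum>j\<in>C. real (c j) * ((1 / r + \<eta>) * card W))"
    using assms(3) by (intro sum_mono mult_left_mono nonnbr) auto
  also have "\<dots> = real (\<Sum>j\<in>C. c j) * ((1 / r + \<eta>) * card W)" by (simp add: sum_distrib_right)
  also have "(\<Sum>j\<in>C. c j) = 2 * r - 1"
  proof -
    have "(\<Sum>j\<in>C. c j) = (\<Sum>j\<in>I. c j) + (\<Sum>j\<in>C-I. c j)"
      using assms(5) finC by (metis add.commute sum.subset_diff)
    also have "(\<Sum>j\<in>I. c j) = 3" using assms(6) by (simp add: c_def)
    also have "(\<Sum>j\<in>C-I. c j) = 2 * (Suc r - 3)"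
      using assms finI by (simp add: c_def card_Diff_subset)
    finally show ?thesis using \<open>r \<ge> 2\<close> by simp
  qed
  also have "real (2 * r - 1) = 2 * real r - 1" using \<open>r \<ge> 2\<close> by simp
  finally have "2 * real (card U) \<le> (2 * real r - 1) * (1 / r + \<eta>) * card W" by simp
  then have "2 * (1 - 3 * \<gamma>) * card W \<le> (2 * real r - 1) * (1 / r + \<eta>) * card W"
    using U by (simp add: algebra_simps)
  then have "2 * (1 - 3 * \<gamma>) \<le> (2 * real r - 1) * (1 / r + \<eta>)"
    using wpos by (simp add: mult_le_cancel_right_pos)
  also have "\<dots> = 2 - 1 / r + (2 * real r - 1) * \<eta>"
    using \<open>r \<ge> 2\<close> by (simp add: field_simps)
  finally show False using assms(8) by simp
qed

text \<open>Here \<open>F\<close> collects the vertices of the clique that have not been replaced yet.  As long as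
  \<open>card F \<ge> 3\<close>, one of them has many replacements, and at the end two original vertices are left.\<close>

lemma cliques_through_pairs:
  fixes g :: real
  assumes "simple_edges E" "finite W" "g \<ge> 0"
    and repl: "\<And>C I. C \<in> cliques E W (Suc r) \<Longrightarrow> I \<subseteq> C \<Longrightarrow> card I = 3 \<Longrightarrow>
        \<exists>i\<in>I. real (card {y\<in>W. \<forall>x\<in>C-{i}. {y, x} \<in> E}) \<ge> g"
  shows "C \<in> cliques E W (Suc r) \<Longrightarrow> F \<subseteq> C \<Longrightarrow> card F = f + 2 \<Longrightarrow>
     real (card {C' \<in> cliques E W (Suc r). C - F \<subseteq> C' \<and> 2 \<le> card (C' \<inter> F)}) \<ge> (g / Suc r)^f"
proof (induction f arbitrary: C F)
  case 0
  have "finite C" using 0 assms(2) finite_subset by (auto simp: cliques_def)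
  have "C \<inter> F = F" using 0 by auto
  then have "C \<in> {C' \<in> cliques E W (Suc r). C - F \<subseteq> C' \<and> 2 \<le> card (C' \<inter> F)}" using 0 by auto
  moreover have "finite {C' \<in> cliques E W (Suc r). C - F \<subseteq> C' \<and> 2 \<le> card (C' \<inter> F)}"
    using finite_cliques[OF assms(2)] by auto
  ultimately have "card {C' \<in> cliques E W (Suc r). C - F \<subseteq> C' \<and> 2 \<le> card (C' \<inter> F)} > 0"
    by (metis (no_types, lifting) card_gt_0_iff empty_iff)
  then show ?case by simp
next
  case (Suc f)
  define G where "G C F = {C' \<in> cliques E W (Suc r). C - F \<subseteq> C' \<and> 2 \<le> card (C' \<inter> F)}" for C F
  have finG: "finite (G C F)" for C F unfolding G_def using finite_cliques[OF assms(2)] by auto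
  have finC: "finite C" using Suc assms(2) finite_subset by (auto simp: cliques_def)
  obtain I where I: "I \<subseteq> F" "card I = 3" using obtain_subset_with_card_n[of 3 F] Suc(4) by auto
  then obtain i where i: "i \<in> I" and big: "real (card {y\<in>W. \<forall>x\<in>C-{i}. {y, x} \<in> E}) \<ge> g"
    using repl[OF Suc(2), of I] Suc(3) by auto
  define Y where "Y = {y\<in>W. \<forall>x\<in>C-{i}. {y, x} \<in> E}"
  have iF: "i \<in> F" "i \<in> C" using i I Suc by auto
  have finY: "finite Y" using assms(2) by (auto simp: Y_def)
  have step: "(g / Suc r)^f \<le> real (card {C' \<in> G C F. y \<in> C'})" if y: "y \<in> Y" for y
  proof -
    define C1 where "C1 = insert y (C - {i})"
    have ynot: "y \<notin> C - {i}" using y no_loop[OF assms(1), of y] unfolding Y_def by blast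
    have "card C1 = Suc r" using ynot finC iF Suc(2) by (simp add: C1_def cliques_def)
    moreover have "clique E C1" using Suc(2) y
      by (auto simp: C1_def clique_def cliques_def Y_def insert_commute)
    moreover have "C1 \<subseteq> W" using Suc(2) y by (auto simp: C1_def cliques_def Y_def)
    ultimately have "C1 \<in> cliques E W (Suc r)" by (simp add: cliques_def)
    moreover have "F - {i} \<subseteq> C1" using Suc(3) by (auto simp: C1_def)
    moreover have "card (F - {i}) = f + 2" using Suc(4) iF finC Suc(3) finite_subset by auto
    ultimately have "(g / Suc r)^f \<le> real (card (G C1 (F - {i})))"
      using Suc(1) by (simp add: G_def)
    \<comment> \<open>Since \<open>y\<close> lies outside \<open>F - {i}\<close>, it belongs to the
      part of \<open>C1\<close> that is kept from now on.\<close>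
    also have "G C1 (F - {i}) \<subseteq> {C' \<in> G C F. y \<in> C'}"
    proof
      fix C' assume C': "C' \<in> G C1 (F - {i})"
      then have "finite C'" using assms(2) finite_subset by (auto simp: cliques_def G_def)
      then have "card (C' \<inter> (F - {i})) \<le> card (C' \<inter> F)" by (intro card_mono) auto
      moreover have "y \<in> C1 - (F - {i})" using ynot Suc(3) by (auto simp: C1_def)
      moreover have "C - F \<subseteq> C1 - (F - {i})" using iF by (auto simp: C1_def)
      ultimately show "C' \<in> {C' \<in> G C F. y \<in> C'}" using C' by (auto simp: G_def)
    qed
    then have "card (G C1 (F - {i})) \<le> card {C' \<in> G C F. y \<in> C'}"
      using finG by (intro card_mono) auto
    finally show ?thesis by simp
  qed
  have "g * (g / Suc r)^f \<le> card Y * (g / Suc r)^f"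
    using big assms(3) by (intro mult_right_mono) (auto simp: Y_def)
  also have "\<dots> \<le> (\<Sum>y\<in>Y. real (card {C' \<in> G C F. y \<in> C'}))"
    using sum_mono[of Y "\<lambda>_. (g / Suc r)^f", OF step] by simp
  also have "\<dots> = real (\<Sum>y\<in>Y. \<Sum>C'\<in>{C' \<in> G C F. y \<in> C'}. 1)" by simp
  also have "(\<Sum>y\<in>Y. \<Sum>C'\<in>{C' \<in> G C F. y \<in> C'}. 1::nat) = (\<Sum>C'\<in>G C F. \<Sum>y\<in>{y\<in>Y. y \<in> C'}. 1)"
    using finY finG by (intro sum.swap_restrict)
  \<comment> \<open>A clique contains at most \<open>Suc r\<close> of the vertices \<open>y\<close>,
    so double counting loses at most this factor per replacement.\<close>
  also have "\<dots> \<le> (\<Sum>C'\<in>G C F. Suc r)"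
  proof (intro sum_mono)
    fix C' assume "C' \<in> G C F"
    then have C': "finite C'" "card C' = Suc r"
      using assms(2) finite_subset by (auto simp: cliques_def G_def)
    have "card {y\<in>Y. y \<in> C'} \<le> card C'" using C' by (intro card_mono) auto
    then show "(\<Sum>y\<in>{y\<in>Y. y \<in> C'}. 1) \<le> Suc r" using C' by simp
  qed
  also have "\<dots> = card (G C F) * Suc r" by simp
  finally have "g * (g / Suc r)^f \<le> real (card (G C F)) * real (Suc r)"
    by (metis of_nat_le_iff of_nat_mult order_trans)
  then have "(g / Suc r)^Suc f \<le> real (card (G C F))"
    by (simp add: divide_simps mult_ac)
  then show ?case by (simp add: G_def)
qed


text \<open>In the dense subgraph \<open>W\<close> every clique of this size has replaceable
  vertices. Replacing all but two vertices of one clique \<open>C\<close> gives about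
  \<open>card V ^ (r - 1)\<close> cliques, each sharing two vertices with \<open>C\<close>. One of
  the boundedly many pairs in \<open>C\<close> must occur often.\<close>

lemma edge_in_many_cliques:
  assumes "r > 0"
  shows "\<exists>\<delta>>0. \<exists>n0. \<forall>(E :: 'v set set) V. simple_edges E \<longrightarrow> finite V \<longrightarrow> n0 \<le> card V \<longrightarrow>
     card (edges_in E V) > turan (card V) r \<longrightarrow>
     (\<exists>p\<in>V. \<exists>q\<in>V. p \<noteq> q \<and> {p, q} \<in> E \<and>
        \<delta> * real (card V)^(r - 1) \<le> real (card {C \<in> cliques E V (Suc r). {p, q} \<subseteq> C}))"
proof -
  \<comment> \<open>The choices of \<open>\<eta>\<close> and \<open>\<gamma>\<close> make both terms
    of the condition in \<open>replaceable\<close> at most \<open>1 / (4 * r)\<close>. In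
    \<open>\<delta>\<close>, the factor \<open>8 * r\<close> is the loss from \<open>V\<close> to
    \<open>W\<close>, each replacement costs \<open>Suc r\<close>, and \<open>C\<close> has at most
    \<open>(Suc r)^2\<close> ordered pairs.\<close>
  define \<eta> where "\<eta> = 1 / (8 * (real r)^2)"
  define \<gamma> where "\<gamma> = 1 / (24 * real r)"
  define \<delta> where "\<delta> = (\<gamma> / (8 * real r * Suc r))^(r - 1) / (real (Suc r))^2"
  have r1: "real r \<ge> 1" using assms by simp
  have "1 \<le> 8 * (real r)^2" using one_le_power[OF r1, of 2] by linarith
  then have eta: "0 < \<eta>" "\<eta> \<le> 1" unfolding \<eta>_def
    by (metis zero_less_divide_1_iff zero_less_one order_less_le_trans,
        metis divide_le_eq_1_pos zero_less_one order_less_le_trans)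
  have small: "6 * \<gamma> + (2 * real r - 1) * \<eta> < 1 / r"
  proof -
    define q where "q = 1 / real r"
    have "q > 0" using r1 by (simp add: q_def)
    have "(2 * real r - 1) * \<eta> \<le> 2 * real r * \<eta>" using eta by (intro mult_right_mono) auto
    also have "\<dots> = q / 4" using r1 by (simp add: \<eta>_def q_def power2_eq_square)
    finally have "(2 * real r - 1) * \<eta> \<le> q / 4" .
    moreover have "6 * \<gamma> = q / 4" by (simp add: \<gamma>_def q_def)
    ultimately show ?thesis using \<open>q > 0\<close> unfolding q_def[symmetric] by linarith
  qed
  have "\<delta> > 0" using r1 by (simp add: \<delta>_def \<gamma>_def)
  moreover have "\<exists>p\<in>V. \<exists>q\<in>V. p \<noteq> q \<and> {p, q} \<in> E \<and>
        \<delta> * real (card V)^(r - 1) \<le> real (card {C \<in> cliques E V (Suc r). {p, q} \<subseteq> C})"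
    if E: "simple_edges E" "finite V" "128 * r ^ 3 \<le> card V" "card (edges_in E V) > turan (card V) r"
    for E :: "'v set set" and V
  proof -
    obtain W where W: "W \<subseteq> V" "card (edges_in E W) > turan (card W) r"
      and nonnbr: "\<And>v. v \<in> W \<Longrightarrow> real (card (W - nbrs E W v)) \<le> 1 + (1 / r + \<eta> / 2) * card W"
      and size: "\<eta> * (real (card V))^2 \<le> 8 * (real (card W))^2"
      using dense_subgraph[OF E(1,2) assms eta E(4)] by blast
    have finW: "finite W" using W(1) E(2) finite_subset by auto
    have VW: "real (card V) / (8 * r) \<le> card W"
    proof -
      have "(real (card V) / (8 * r))^2 \<le> (real (card W))^2"
        using size r1 by (simp add: \<eta>_def power_divide power_mult_distrib field_simps)
      then show ?thesis by (rule power2_le_imp_le) simp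
    qed
    \<comment> \<open>This lower bound on \<open>card V\<close> gives
      \<open>16 * r^2 \<le> card W\<close>, so that the additive 1 in the bound on non-neighbours is
      absorbed by \<open>\<eta> / 2 * card W\<close>.\<close>
    have "128 * (real r)^3 \<le> card V" using E(3) by (metis of_nat_le_iff of_nat_mult of_nat_numeral of_nat_power)
    then have "128 * (real r)^3 / (8 * r) \<le> real (card V) / (8 * r)" by (intro divide_right_mono) auto
    then have "16 * (real r)^2 \<le> card W"
      using VW r1 by (simp add: power2_eq_square power3_eq_cube)
    then have "1 \<le> \<eta> / 2 * card W" using r1 by (simp add: \<eta>_def field_simps)
    then have nonnbr': "real (card (W - nbrs E W v)) \<le> (1 / r + \<eta>) * card W" if "v \<in> W" for v
      using nonnbr[OF that] by (simp add: algebra_simps)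
    obtain C where C: "C \<subseteq> W" "card C = Suc r" "clique E C"
      using turan_theorem[OF E(1) finW assms W(2)] by blast
    then have finC: "finite C" using finW finite_subset by auto
    have repl: "\<exists>i\<in>I. real (card {y\<in>W. \<forall>x\<in>C'-{i}. {y, x} \<in> E}) \<ge> \<gamma> * card W"
      if "C' \<in> cliques E W (Suc r)" "I \<subseteq> C'" "card I = 3" for C' I
      using replaceable[OF finW, of E C' r I \<eta> \<gamma>] that nonnbr' small by (auto simp: cliques_def)
    define g where "g = \<gamma> * card W"
    have "g \<ge> 0" using r1 by (simp add: g_def \<gamma>_def)
    define G where "G = {C' \<in> cliques E W (Suc r). C - C \<subseteq> C' \<and> 2 \<le> card (C' \<inter> C)}"
    define H where "H e = {C \<in> cliques E V (Suc r). {fst e, snd e} \<subseteq> C}" for e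
    have finH: "finite (H e)" for e using finite_cliques[OF E(2)] by (simp add: H_def)
    define P where "P = {e \<in> C \<times> C. fst e \<noteq> snd e}"
    have finP: "finite P" using finC by (simp add: P_def)
    have "(g / Suc r)^(r - 1) \<le> real (card G)"
      using cliques_through_pairs[OF E(1) finW \<open>g \<ge> 0\<close>, of r C C "r - 1"] repl C assms
      by (simp add: G_def g_def cliques_def)
    also have "card G \<le> card (\<Union>e\<in>P. H e)"
    proof (intro card_mono)
      show "finite (\<Union>e\<in>P. H e)" using finP finH by auto
      show "G \<subseteq> (\<Union>e\<in>P. H e)"
      proof
        fix C' assume C': "C' \<in> G"
        then have "2 \<le> card (C' \<inter> C)" by (simp add: G_def)
        then obtain T where T: "T \<subseteq> C' \<inter> C" "card T = 2"
          using obtain_subset_with_card_n by metis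
        then obtain x y where "x \<noteq> y" "T = {x, y}" by (metis card_2_iff)
        then have "x \<noteq> y" "{x, y} \<subseteq> C' \<inter> C" using T by auto
        then show "C' \<in> (\<Union>e\<in>P. H e)" using C' W(1)
          by (auto simp: P_def H_def G_def cliques_def intro!: bexI[of _ "(x, y)"])
      qed
    qed
    also have "card (\<Union>e\<in>P. H e) \<le> (\<Sum>e\<in>P. card (H e))" by (rule card_UN_le[OF finP])
    finally have many: "(g / Suc r)^(r - 1) \<le> real (\<Sum>e\<in>P. card (H e))" by simp
    have "\<delta> * real (card V)^(r - 1) * (real (Suc r))^2 =
        (\<gamma> / Suc r * (real (card V) / (8 * r)))^(r - 1)"
      by (simp add: \<delta>_def power_mult_distrib power_divide)
    also have "\<dots> \<le> (\<gamma> / Suc r * card W)^(r - 1)"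
      using VW r1 by (intro power_mono mult_left_mono) (auto simp: \<gamma>_def)
    also have "\<dots> = (g / Suc r)^(r - 1)" by (simp add: g_def)
    finally have tot: "\<delta> * real (card V)^(r - 1) * (real (Suc r))^2 \<le> real (\<Sum>e\<in>P. card (H e))"
      using many by linarith
    have "\<exists>e\<in>P. \<delta> * real (card V)^(r - 1) \<le> real (card (H e))"
    proof (rule ccontr)
      assume "\<not> ?thesis"
      then have less: "\<And>e. e \<in> P \<Longrightarrow> real (card (H e)) < \<delta> * real (card V)^(r - 1)" by force
      have "2 \<le> card C" using C assms by simp
      then obtain T where T: "T \<subseteq> C" "card T = 2" using obtain_subset_with_card_n by metis
      then obtain x y where "x \<noteq> y" "T = {x, y}" by (metis card_2_iff)
      then have "x \<in> C" "y \<in> C" "x \<noteq> y" using T by auto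
      then have "P \<noteq> {}" by (force simp: P_def)
      then have "(\<Sum>e\<in>P. real (card (H e))) < (\<Sum>e\<in>P. \<delta> * real (card V)^(r - 1))"
        using less finP by (intro sum_strict_mono) auto
      also have "\<dots> = real (card P) * (\<delta> * real (card V)^(r - 1))" by simp
      also have "\<dots> \<le> (real (Suc r))^2 * (\<delta> * real (card V)^(r - 1))"
      proof (intro mult_right_mono)
        have "card P \<le> card (C \<times> C)" using finC by (intro card_mono) (auto simp: P_def)
        then show "real (card P) \<le> (real (Suc r))^2"
          using C(2) by (simp add: card_cartesian_product power2_eq_square flip: of_nat_mult of_nat_Suc)
      qed (use \<open>\<delta> > 0\<close> in auto)
      finally show False using tot by (simp add: mult_ac)
    qed
    then obtain p q where pq: "p \<in> C" "q \<in> C" "p \<noteq> q" "\<delta> * real (card V)^(r - 1) \<le> real (card (H (p, q)))"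
      by (auto simp: P_def)
    then have "{p, q} \<in> E" "p \<in> V" "q \<in> V" using C W(1) by (auto simp: clique_def)
    moreover have "\<delta> * real (card V)^(r - 1) \<le> real (card {C \<in> cliques E V (Suc r). {p, q} \<subseteq> C})"
      using pq(4) by (simp add: H_def)
    ultimately show ?thesis using pq(3) by blast
  qed
  ultimately show ?thesis by blast
qed

text \<open>Remove an edge that lies in many cliques. This destroys all cliques through it and
  lowers the excess by one, so each of the \<open>x\<close> excess edges contributes its own
  cliques.\<close>

lemma many_cliques:
  assumes "r > 0"
  shows "\<exists>\<delta>>0. \<exists>n0. \<forall>(E :: 'v set set) V x. simple_edges E \<longrightarrow> finite V \<longrightarrow> n0 \<le> card V \<longrightarrow>
     card (edges_in E V) \<ge> turan (card V) r + x \<longrightarrow>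
     real x * \<delta> * real (card V)^(r - 1) \<le> real (card (cliques E V (Suc r)))"
proof -
  obtain \<delta> n0 where "\<delta> > 0" and step:
    "\<And>(E :: 'v set set) V. simple_edges E \<Longrightarrow> finite V \<Longrightarrow> n0 \<le> card V \<Longrightarrow>
     card (edges_in E V) > turan (card V) r \<Longrightarrow>
     (\<exists>p\<in>V. \<exists>q\<in>V. p \<noteq> q \<and> {p, q} \<in> E \<and>
        \<delta> * real (card V)^(r - 1) \<le> real (card {C \<in> cliques E V (Suc r). {p, q} \<subseteq> C}))"
    using edge_in_many_cliques[OF assms, where 'v = 'v] by blast
  have "real x * \<delta> * real (card V)^(r - 1) \<le> real (card (cliques E V (Suc r)))"
    if "simple_edges E" "finite V" "n0 \<le> card V" "card (edges_in E V) \<ge> turan (card V) r + x"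
    for E :: "'v set set" and V x
    using that
  proof (induction x arbitrary: E)
    case (Suc x)
    then obtain p q where pq: "p \<in> V" "q \<in> V" "p \<noteq> q" "{p, q} \<in> E"
      and many: "\<delta> * real (card V)^(r - 1) \<le> real (card {C \<in> cliques E V (Suc r). {p, q} \<subseteq> C})"
      using step[of E V] by auto
    define E' where "E' = E - {{p, q}}"
    have "finite (edges_in E V)"
      by (rule finite_subset[of _ "Pow V"]) (auto simp: edges_in_def Suc)
    moreover have "edges_in E' V = edges_in E V - {{p, q}}" "{p, q} \<in> edges_in E V"
      using pq by (auto simp: edges_in_def E'_def)
    ultimately have "card (edges_in E' V) \<ge> turan (card V) r + x"
      using Suc(5) by simp
    moreover have "simple_edges E'" using Suc(2) by (auto simp: simple_edges_def E'_def)
    ultimately have IH: "real x * \<delta> * real (card V)^(r - 1) \<le> real (card (cliques E' V (Suc r)))"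
      using Suc by blast
    have fin: "finite (cliques E V (Suc r))" using finite_cliques Suc by blast
    have "cliques E' V (Suc r) \<union> {C \<in> cliques E V (Suc r). {p, q} \<subseteq> C} \<subseteq> cliques E V (Suc r)"
      by (auto simp: cliques_def clique_def E'_def)
    then have "card (cliques E' V (Suc r) \<union> {C \<in> cliques E V (Suc r). {p, q} \<subseteq> C}) \<le> card (cliques E V (Suc r))"
      using fin by (rule card_mono[rotated])
    moreover have "card (cliques E' V (Suc r) \<union> {C \<in> cliques E V (Suc r). {p, q} \<subseteq> C}) =
       card (cliques E' V (Suc r)) + card {C \<in> cliques E V (Suc r). {p, q} \<subseteq> C}"
    proof (intro card_Un_disjoint)
      show "cliques E' V (Suc r) \<inter> {C \<in> cliques E V (Suc r). {p, q} \<subseteq> C} = {}"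
        using pq by (auto simp: cliques_def clique_def E'_def)
    qed (use fin finite_cliques Suc in auto)
    ultimately have "real (card (cliques E' V (Suc r))) + real (card {C \<in> cliques E V (Suc r). {p, q} \<subseteq> C})
        \<le> real (card (cliques E V (Suc r)))" by linarith
    then show ?case using IH many by (simp add: algebra_simps)
  qed simp
  then show ?thesis using \<open>\<delta> > 0\<close> by blast
qed

section \<open>Grids and packing\<close>

text \<open>Cubes of side \<open>h / DIM('a)\<close> have diameter at most \<open>h\<close> because
  the norm is bounded by the sum of the coordinates. The index of a cube is restricted to
  \<open>Basis\<close>, so that the indices met by a ball lie in a finite product of integer
  intervals.\<close>

lemma grid_cover:
  fixes z :: "'a::euclidean_space" and h :: real
  assumes "h > 0"
  obtains g :: "'a \<Rightarrow> 'a \<Rightarrow> int"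
  where "\<And>x y. g x = g y \<Longrightarrow> dist x y < h"
    and "\<And>X. X \<subseteq> cball z \<rho> \<Longrightarrow> \<rho> \<ge> 0 \<Longrightarrow> real (card (g ` X)) \<le> (2 * \<rho> * DIM('a) / h + 2)^DIM('a)"
proof
  define s where "s = h / DIM('a)"
  define g where "g x = restrict (\<lambda>b. \<lfloor>(x \<bullet> b) / s\<rfloor>) Basis" for x :: 'a
  define J where "J b = {\<lfloor>(z \<bullet> b - \<rho>) / s\<rfloor>..\<lfloor>(z \<bullet> b + \<rho>) / s\<rfloor>}" for b
  have s: "s > 0" using assms by (simp add: s_def)
  show "dist x y < h" if "g x = g y" for x y
  proof -
    have "\<bar>(x - y) \<bullet> b\<bar> < s" if "b \<in> Basis" for b
    proof -
      have "\<lfloor>(x \<bullet> b) / s\<rfloor> = \<lfloor>(y \<bullet> b) / s\<rfloor>"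
        using fun_cong[OF \<open>g x = g y\<close>, of b] that by (simp add: g_def)
      then have "\<bar>(x \<bullet> b) / s - (y \<bullet> b) / s\<bar> < 1" by linarith
      moreover have "(x \<bullet> b) / s - (y \<bullet> b) / s = ((x - y) \<bullet> b) / s"
        by (simp add: inner_diff_left diff_divide_distrib)
      ultimately show ?thesis using s by (simp add: abs_divide)
    qed
    then have "(\<Sum>b\<in>Basis. \<bar>(x - y) \<bullet> b\<bar>) < (\<Sum>b\<in>(Basis::'a set). s)"
      by (intro sum_strict_mono) auto
    also have "\<dots> = h" by (simp add: s_def)
    finally show ?thesis using norm_le_l1[of "x - y"] by (simp add: dist_norm)
  qed
  have sub: "g ` X \<subseteq> PiE Basis J" if "X \<subseteq> cball z \<rho>" for X
  proof -
    have "g x b \<in> J b" if "x \<in> X" "b \<in> Basis" for x b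
    proof -
      have "dist z x \<le> \<rho>" using that \<open>X \<subseteq> cball z \<rho>\<close> by auto
      then have "\<bar>(x - z) \<bullet> b\<bar> \<le> \<rho>"
        using Basis_le_norm[OF that(2), of "x - z"] by (simp add: dist_norm norm_minus_commute)
      then have "z \<bullet> b - \<rho> \<le> x \<bullet> b" "x \<bullet> b \<le> z \<bullet> b + \<rho>"
        by (auto simp: inner_diff_left)
      then show ?thesis using that s by (auto simp: g_def J_def intro!: floor_mono divide_right_mono)
    qed
    then show ?thesis by (auto simp: g_def)
  qed
  have finP: "finite (PiE (Basis :: 'a set) J)" by (intro finite_PiE) (auto simp: J_def)
  show "real (card (g ` X)) \<le> (2 * \<rho> * DIM('a) / h + 2)^DIM('a)"
    if "X \<subseteq> cball z \<rho>" "\<rho> \<ge> 0" for X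
  proof -
    have "real (card (g ` X)) \<le> real (card (PiE (Basis::'a set) J))"
      using sub[OF that(1)] finP by (simp add: card_mono)
    also have "\<dots> = (\<Prod>b\<in>(Basis::'a set). real (card (J b)))"
      by (simp add: card_PiE)
    also have "\<dots> \<le> (\<Prod>b\<in>(Basis::'a set). 2 * \<rho> * DIM('a) / h + 2)"
    proof (intro prod_mono conjI)
      fix b :: 'a
      have "(z \<bullet> b + \<rho>) / s = (z \<bullet> b - \<rho>) / s + 2 * \<rho> / s"
        by (simp add: add_divide_distrib diff_divide_distrib)
      moreover have "2 * \<rho> / s \<ge> 0" using that s by simp
      ultimately have "real_of_int (\<lfloor>(z \<bullet> b + \<rho>) / s\<rfloor> - \<lfloor>(z \<bullet> b - \<rho>) / s\<rfloor> + 1) \<le> 2 * \<rho> / s + 2"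
        by linarith
      moreover have "2 * \<rho> / s = 2 * \<rho> * DIM('a) / h" using assms by (simp add: s_def)
      moreover have "real (card (J b)) = max 0 (real_of_int (\<lfloor>(z \<bullet> b + \<rho>) / s\<rfloor> - \<lfloor>(z \<bullet> b - \<rho>) / s\<rfloor> + 1))"
        by (simp add: J_def)
      moreover have "0 \<le> 2 * \<rho> * DIM('a) / h + 2" using that assms by simp
      ultimately show "real (card (J b)) \<le> 2 * \<rho> * DIM('a) / h + 2" by linarith
    qed simp
    also have "\<dots> = (2 * \<rho> * DIM('a) / h + 2)^DIM('a)" by simp
    finally show ?thesis .
  qed
qed

lemma card_le_fibers:
  fixes B :: real
  assumes "finite X" "\<And>x. x \<in> X \<Longrightarrow> real (card {y \<in> X. g y = g x}) \<le> B"
  shows "real (card X) \<le> real (card (g ` X)) * B"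
proof -
  have "X = (\<Union>c\<in>g ` X. {y \<in> X. g y = c})" by auto
  then have "card X \<le> (\<Sum>c\<in>g ` X. card {y \<in> X. g y = c})"
    using card_UN_le[of "g ` X" "\<lambda>c. {y \<in> X. g y = c}"] assms(1) by simp
  then have "real (card X) \<le> (\<Sum>c\<in>g ` X. real (card {y \<in> X. g y = c}))"
    by (metis of_nat_le_iff of_nat_sum)
  also have "\<dots> \<le> (\<Sum>c\<in>g ` X. B)" using assms(2) by (intro sum_mono) auto
  finally show ?thesis by simp
qed

text \<open>A grid cell in which all distances are below 1 contains at most one point of a separated
  set.\<close>

lemma separated_ball_card:
  fixes X :: "'a::euclidean_space set"
  assumes "separated X" "X \<subseteq> cball z \<rho>" "\<rho> \<ge> 0"
  shows "real (card X) \<le> (2 * \<rho> * DIM('a) + 2)^DIM('a)"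
proof -
  obtain g :: "'a \<Rightarrow> 'a \<Rightarrow> int" where g: "\<And>x y. g x = g y \<Longrightarrow> dist x y < 1"
    and c: "\<And>X. X \<subseteq> cball z \<rho> \<Longrightarrow> \<rho> \<ge> 0 \<Longrightarrow> real (card (g ` X)) \<le> (2 * \<rho> * DIM('a) / 1 + 2)^DIM('a)"
    using grid_cover[of 1 z \<rho>] by (metis zero_less_one)
  have "inj_on g X"
    using g assms(1) by (force simp: inj_on_def separated_def)
  then have "card (g ` X) = card X" by (rule card_image)
  then show ?thesis using c[OF assms(2,3)] by simp
qed

section \<open>Boundedness of nearly k-distance sets and maximality of \<open>A\<close>\<close>

text \<open>Induction on the number of distances. If \<open>t\<close> is the largest,
  \<open>X\<close> lies in a ball of radius \<open>t + 1\<close>, and points in a common grid cell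
  have distance below \<open>t\<close>, hence use only the remaining distances. The number of cells
  is bounded independently of \<open>t\<close>, because \<open>t + 1 \<le> 2 * t\<close>.\<close>

lemma card_le_of_distances:
  "\<exists>B::nat. \<forall>(X::'a::euclidean_space set) T. finite X \<longrightarrow> finite T \<longrightarrow> card T \<le> k \<longrightarrow> (\<forall>t\<in>T. 1 \<le> t) \<longrightarrow>
     (\<forall>x\<in>X. \<forall>y\<in>X. x \<noteq> y \<longrightarrow> (\<exists>t\<in>T. t \<le> dist x y \<and> dist x y \<le> t + 1)) \<longrightarrow> card X \<le> B"
proof (induction k)
  case 0
  show ?case
  proof (intro exI[of _ 1] allI impI)
    fix X :: "'a set" and T :: "real set"
    assume "finite X" "finite T" "card T \<le> 0"
      "\<forall>x\<in>X. \<forall>y\<in>X. x \<noteq> y \<longrightarrow> (\<exists>t\<in>T. t \<le> dist x y \<and> dist x y \<le> t + 1)"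
    then have "\<forall>x\<in>X. \<forall>y\<in>X. x = y" by auto
    then show "card X \<le> 1" using \<open>finite X\<close> by (simp add: card_le_Suc0_iff_eq)
  qed
next
  case (Suc k)
  then obtain B where B: "\<And>(X::'a set) T. finite X \<Longrightarrow> finite T \<Longrightarrow> card T \<le> k \<Longrightarrow> (\<forall>t\<in>T. 1 \<le> t) \<Longrightarrow>
     (\<forall>x\<in>X. \<forall>y\<in>X. x \<noteq> y \<longrightarrow> (\<exists>t\<in>T. t \<le> dist x y \<and> dist x y \<le> t + 1)) \<Longrightarrow> card X \<le> B" by blast
  show ?case
  proof (intro exI[of _ "B + (4 * DIM('a) + 2)^DIM('a) * B"] allI impI)
    fix X :: "'a set" and T :: "real set"
    assume X: "finite X" "finite T" "card T \<le> Suc k" "\<forall>t\<in>T. 1 \<le> t"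
      and dist: "\<forall>x\<in>X. \<forall>y\<in>X. x \<noteq> y \<longrightarrow> (\<exists>t\<in>T. t \<le> dist x y \<and> dist x y \<le> t + 1)"
    show "card X \<le> B + (4 * DIM('a) + 2)^DIM('a) * B"
    proof (cases "T = {} \<or> X = {}")
      case True
      then have "card X \<le> B" using B[OF X(1,2)] X dist by auto
      then show ?thesis by simp
    next
      case False
      define t where "t = Max T"
      have t: "t \<in> T" "\<And>s. s \<in> T \<Longrightarrow> s \<le> t" using False X(2) by (auto simp: t_def)
      then have t1: "t \<ge> 1" using X by auto
      obtain z where z: "z \<in> X" using False by auto
      have "dist z x \<le> t + 1" if "x \<in> X" for x
      proof (cases "x = z")
        case False
        then show ?thesis using dist z that t(2) by fastforce
      qed (use t1 in auto)
      then have Xb: "X \<subseteq> cball z (t + 1)" by auto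
      obtain g :: "'a \<Rightarrow> 'a \<Rightarrow> int" where g: "\<And>x y. g x = g y \<Longrightarrow> dist x y < t"
        and c: "\<And>X. X \<subseteq> cball z (t + 1) \<Longrightarrow> t + 1 \<ge> 0 \<Longrightarrow>
            real (card (g ` X)) \<le> (2 * (t + 1) * DIM('a) / t + 2)^DIM('a)"
        using grid_cover[of t z "t + 1"] t1 by (metis zero_less_one order_less_le_trans)
      have "real (card {y \<in> X. g y = g x}) \<le> real B" for x
      proof -
        have "card {y \<in> X. g y = g x} \<le> B"
        proof (rule B[of _ "T - {t}"])
          show "card (T - {t}) \<le> k" using X t by simp
          show "\<forall>y\<in>{y \<in> X. g y = g x}. \<forall>y'\<in>{y \<in> X. g y = g x}. y \<noteq> y' \<longrightarrow>
              (\<exists>s\<in>T - {t}. s \<le> dist y y' \<and> dist y y' \<le> s + 1)"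
          proof (intro ballI impI)
            fix y y' assume y: "y \<in> {y \<in> X. g y = g x}" "y' \<in> {y \<in> X. g y = g x}" "y \<noteq> y'"
            then have "dist y y' < t" using g by simp
            moreover obtain s where "s \<in> T" "s \<le> dist y y'" "dist y y' \<le> s + 1" using y dist by blast
            ultimately show "\<exists>s\<in>T - {t}. s \<le> dist y y' \<and> dist y y' \<le> s + 1" by force
          qed
        qed (use X in auto)
        then show ?thesis by simp
      qed
      then have "real (card X) \<le> real (card (g ` X)) * real B"
        by (intro card_le_fibers X(1)) simp
      also have "\<dots> \<le> (2 * (t + 1) * DIM('a) / t + 2)^DIM('a) * real B"
        using c[OF Xb] t1 by (intro mult_right_mono) auto
      also have "\<dots> \<le> (4 * real DIM('a) + 2)^DIM('a) * real B"
      proof (intro mult_right_mono power_mono)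
        have "2 * (t + 1) * DIM('a) / t \<le> 2 * (2 * t) * DIM('a) / t"
          using t1 by (intro divide_right_mono mult_right_mono) auto
        then show "2 * (t + 1) * DIM('a) / t + 2 \<le> 4 * real DIM('a) + 2" using t1 by simp
      qed (use t1 in auto)
      also have "\<dots> = real ((4 * DIM('a) + 2)^DIM('a) * B)" by (simp add: add.commute)
      finally have "real (card X) \<le> real ((4 * DIM('a) + 2)^DIM('a) * B)" .
      then have "card X \<le> (4 * DIM('a) + 2)^DIM('a) * B" by (simp only: of_nat_le_iff)
      then show ?thesis by simp
    qed
  qed
qed

text \<open>Bounds the candidates in the definition of \<open>A_gen\<close>, already for
  \<open>\<epsilon> = 1\<close>, so that its \<open>GREATEST\<close> is attained.\<close>

lemma nearly_k_distance_card_le: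
  "\<exists>B. \<forall>P::'a::euclidean_space set. finite P \<longrightarrow> nearly_k_distance k 1 P \<longrightarrow> card P \<le> B"
proof -
  obtain B where B: "\<And>(X::'a set) T. finite X \<Longrightarrow> finite T \<Longrightarrow> card T \<le> k \<Longrightarrow> (\<forall>t\<in>T. 1 \<le> t) \<Longrightarrow>
     (\<forall>x\<in>X. \<forall>y\<in>X. x \<noteq> y \<longrightarrow> (\<exists>t\<in>T. t \<le> dist x y \<and> dist x y \<le> t + 1)) \<Longrightarrow> card X \<le> B"
    using card_le_of_distances[of k] by blast
  have "card P \<le> B" if P: "finite P" "nearly_k_distance k 1 P" for P :: "'a set"
  proof -
    obtain t where t: "1 \<le> t 0" "\<And>i. Suc i < k \<Longrightarrow> t i < t (Suc i)"
      "\<And>p q. p \<in> P \<Longrightarrow> q \<in> P \<Longrightarrow> p \<noteq> q \<Longrightarrow> \<exists>i<k. t i \<le> dist p q \<and> dist p q \<le> t i + (1::real)"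
      using P(2) unfolding nearly_k_distance_def by blast
    have "i < k \<Longrightarrow> 1 \<le> t i" for i
    proof (induction i)
      case (Suc i)
      then show ?case using t(2)[of i] by simp
    qed (use t in simp)
    then show ?thesis
      using t(3) card_image_le[of "{..<k}" t] by (intro B[OF P(1), of "t ` {..<k}"]) force+
  qed
  then show ?thesis by blast
qed

text \<open>Two points at distance 1 qualify for all \<open>\<epsilon>\<close> and
  \<open>\<alpha>\<close>, because two exceptions to flatness are allowed. The second part provides
  the \<open>\<epsilon>\<close> and \<open>\<alpha>\<close> against which the final contradiction is
  derived.\<close>

lemma A_maximal:
  assumes "k \<ge> 1"
  shows "A TYPE('a::euclidean_space) k \<ge> 2"
    and "\<exists>\<epsilon>>0. \<exists>\<alpha>>0. \<forall>P::'a set. finite P \<longrightarrow> card P = Suc (A TYPE('a) k) \<longrightarrow>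
       almost_flat (DIM('a) - 1) \<alpha> P \<longrightarrow> \<not> nearly_k_distance k \<epsilon> P"
proof -
  define Q where "Q N \<longleftrightarrow> (\<forall>\<epsilon>>0. \<forall>\<alpha>>0. \<exists>P::'a set. finite P \<and> card P = N \<and>
       almost_flat (DIM('a) - 1) \<alpha> P \<and> nearly_k_distance k \<epsilon> P)" for N
  have AQ: "A TYPE('a) k = Greatest Q" by (simp add: A_def A_gen_def Q_def[abs_def])
  obtain B where B: "\<And>P::'a set. finite P \<Longrightarrow> nearly_k_distance k 1 P \<Longrightarrow> card P \<le> B"
    using nearly_k_distance_card_le by blast
  have bound: "N \<le> B" if "Q N" for N
    using that B unfolding Q_def by (metis zero_less_one)
  have "Q 2"
    unfolding Q_def
  proof (intro allI impI)
    fix \<epsilon> \<alpha> :: real assume "\<epsilon> > 0" "\<alpha> > 0"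
    obtain b :: 'a where b: "b \<in> Basis" using SOME_Basis by blast
    define P where "P = {0, b}"
    have "b \<noteq> 0" using b by auto
    have "dist 0 b = 1" "dist b 0 = 1" using b by (auto simp: dist_norm)
    then have "nearly_k_distance k \<epsilon> P" unfolding nearly_k_distance_def separated_def P_def
      using \<open>\<epsilon> > 0\<close> assms by (auto intro!: exI[of _ "\<lambda>i. 1 + real i"] exI[of _ 0])
    moreover have "card {p \<in> P. \<not> flat_at P p (DIM('a) - 1) \<alpha>} \<le> card P"
      by (intro card_mono) (auto simp: P_def)
    ultimately show "\<exists>P::'a set. finite P \<and> card P = 2 \<and>
        almost_flat (DIM('a) - 1) \<alpha> P \<and> nearly_k_distance k \<epsilon> P"
      using \<open>b \<noteq> 0\<close> by (intro exI[of _ P]) (auto simp: P_def almost_flat_def)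
  qed
  then show "A TYPE('a) k \<ge> 2" unfolding AQ using bound by (rule Greatest_le_nat)
  have "\<not> Q (Suc (Greatest Q))" using Greatest_le_nat[of Q "Suc (Greatest Q)" B] bound by auto
  then show "\<exists>\<epsilon>>0. \<exists>\<alpha>>0. \<forall>P::'a set. finite P \<longrightarrow> card P = Suc (A TYPE('a) k) \<longrightarrow>
       almost_flat (DIM('a) - 1) \<alpha> P \<longrightarrow> \<not> nearly_k_distance k \<epsilon> P"
    unfolding AQ[symmetric] unfolding Q_def by blast
qed

section \<open>Companions of the vertices of a clique\<close>

definition common_interval :: "nat \<Rightarrow> (nat \<Rightarrow> real) \<Rightarrow> real \<Rightarrow> real \<Rightarrow> real \<Rightarrow> bool" where
  "common_interval k t w x y \<longleftrightarrow> (\<exists>i<k. t i \<le> x \<and> x \<le> t i + w \<and> t i \<le> y \<and> y \<le> t i + w)"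

text \<open>\<open>v'\<close> lies at an intermediate scale: far from \<open>v\<close> compared with \<open>w\<close>, close compared with
  the distances from \<open>v\<close> to \<open>D\<close>.\<close>

definition companion :: "nat \<Rightarrow> (nat \<Rightarrow> real) \<Rightarrow> real \<Rightarrow> real \<Rightarrow> 'a::euclidean_space set \<Rightarrow> 'a \<Rightarrow> 'a \<Rightarrow> bool" where
  "companion k t w K D v v' \<longleftrightarrow> K * w \<le> dist v v' \<and>
     (\<forall>u\<in>D. K * dist v v' \<le> dist v u \<and> common_interval k t w (dist v u) (dist v' u))"

text \<open>The number of choices of the intervals, times the number of grid cells of diameter \<open>t / K\<close>
  that cover a ball of radius \<open>2 t\<close>, times the number of separated points in a ball of radius \<open>K w\<close>,
  without its factor \<open>w^d\<close>.\<close>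

definition fiber_bound :: "'a::euclidean_space itself \<Rightarrow> nat \<Rightarrow> nat \<Rightarrow> real \<Rightarrow> real" where
  "fiber_bound _ k m K = real (k ^ m) * (4 * K * DIM('a) + 2)^DIM('a) * (2 * K * DIM('a) + 2)^DIM('a)"

text \<open>Sort the vertices in question by the intervals of their distances to \<open>D\<close>,
  then by cells of a grid that is fine compared with these distances. Two members of one class at
  distance more than \<open>K * w\<close> would be companions, so each class fits into a ball of
  radius \<open>K * w\<close> and packing applies.\<close>

lemma card_without_companion:
  fixes S D :: "'a::euclidean_space set"
  assumes "separated S" "finite S" "finite D" "D \<noteq> {}" "w \<ge> 1" "K \<ge> 1"
  shows "real (card {v\<in>S. (\<forall>u\<in>D. 2 * w \<le> dist v u \<and> (\<exists>i<k. t i \<le> dist v u \<and> dist v u \<le> t i + w)) \<and>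
             \<not> (\<exists>v'\<in>S. companion k t w K D v v')})
         \<le> fiber_bound TYPE('a) k (card D) K * w^DIM('a)"
proof -
  define X where "X = {v\<in>S. (\<forall>u\<in>D. 2 * w \<le> dist v u \<and> (\<exists>i<k. t i \<le> dist v u \<and> dist v u \<le> t i + w)) \<and>
             \<not> (\<exists>v'\<in>S. companion k t w K D v v')}"
  define ch where "ch v u = (SOME i. i < k \<and> t i \<le> dist v u \<and> dist v u \<le> t i + w)" for v u :: 'a
  have ch: "ch v u < k \<and> t (ch v u) \<le> dist v u \<and> dist v u \<le> t (ch v u) + w"
    if "v \<in> X" "u \<in> D" for v u
  proof -
    have "\<exists>i. i < k \<and> t i \<le> dist v u \<and> dist v u \<le> t i + w" using that by (auto simp: X_def)
    from someI_ex[OF this] show ?thesis by (simp add: ch_def)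
  qed
  define pat where "pat v = restrict (ch v) D" for v :: 'a
  define b1 where "b1 = (4 * K * DIM('a) + 2)^DIM('a)"
  define b2 where "b2 = (2 * (K * w) * DIM('a) + 2)^DIM('a)"
  have b: "b1 \<ge> 0" "b2 \<ge> 0" using assms by (auto simp: b1_def b2_def)
  have finX: "finite X" using assms by (simp add: X_def)
  have sepX: "separated Z" if "Z \<subseteq> X" for Z
    using assms(1) that by (auto simp: separated_def X_def)
  have fib: "real (card {y \<in> X. pat y = pat x}) \<le> b1 * b2" if x: "x \<in> X" for x
  proof -
    define Z where "Z = {y \<in> X. pat y = pat x}"
    have ZX: "Z \<subseteq> X" by (auto simp: Z_def)
    have same: "t (ch x u) \<le> dist v u \<and> dist v u \<le> t (ch x u) + w" if "v \<in> Z" "u \<in> D" for v u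
    proof -
      have "v \<in> X" "pat v = pat x" using that by (auto simp: Z_def)
      then have "ch v u = ch x u" using that(2) unfolding pat_def by (metis restrict_apply')
      then show ?thesis using ch[OF \<open>v \<in> X\<close> that(2)] by simp
    qed
    \<comment> \<open>The smallest left endpoint in use, attained at \<open>us\<close>, sets the
      scale of the grid: all of \<open>Z\<close> is within \<open>ts + w\<close> of
      \<open>us\<close>, and no distance from \<open>Z\<close> to \<open>D\<close> is below
      \<open>ts\<close>. Since these distances are at least \<open>2 * w\<close>, also
      \<open>w \<le> ts\<close>.\<close>
    define ts where "ts = Min ((\<lambda>u. t (ch x u)) ` D)"
    have tsle: "ts \<le> t (ch x u)" if "u \<in> D" for u using that assms(3) by (simp add: ts_def)
    have "ts \<in> (\<lambda>u. t (ch x u)) ` D" unfolding ts_def using assms(3,4) by (intro Min_in) auto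
    then obtain us where us: "us \<in> D" "ts = t (ch x us)" by auto
    have "2 * w \<le> dist x us" using x us by (auto simp: X_def)
    then have tw: "w \<le> ts" using ch[OF x us(1)] us(2) by linarith
    then have tpos: "ts > 0" using assms(5) by linarith
    have Zb: "Z \<subseteq> cball us (ts + w)" using same us by (auto simp: dist_commute)
    have hpos: "ts / K > 0" using tpos assms(6) by simp
    obtain g :: "'a \<Rightarrow> 'a \<Rightarrow> int" where g: "\<And>x y. g x = g y \<Longrightarrow> dist x y < ts / K"
      and c: "\<And>X. X \<subseteq> cball us (ts + w) \<Longrightarrow> ts + w \<ge> 0 \<Longrightarrow>
          real (card (g ` X)) \<le> (2 * (ts + w) * DIM('a) / (ts / K) + 2)^DIM('a)"
      using grid_cover[OF hpos] by metis
    have "real (card {z \<in> Z. g z = g y}) \<le> b2" if y: "y \<in> Z" for y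
    proof -
      have "dist y z \<le> K * w" if z: "z \<in> Z" "g z = g y" for z
      proof (rule ccontr)
        assume far: "\<not> dist y z \<le> K * w"
        have "dist y z < ts / K" using g[of y z] z by simp
        then have near: "K * dist y z \<le> ts" using assms(6) by (simp add: field_simps)
        have "common_interval k t w (dist y u) (dist z u)" if "u \<in> D" for u
          using same[OF y that] same[OF z(1) that] ch[OF x that] by (auto simp: common_interval_def)
        moreover have "K * dist y z \<le> dist y u" if "u \<in> D" for u
          using near tsle[OF that] same[OF y that] by linarith
        ultimately have "companion k t w K D y z" using far by (simp add: companion_def)
        then show False using y z ZX by (auto simp: X_def)
      qed
      then have "{z \<in> Z. g z = g y} \<subseteq> cball y (K * w)" by auto
      moreover have "separated {z \<in> Z. g z = g y}" using ZX by (intro sepX) auto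
      ultimately show ?thesis unfolding b2_def using assms by (intro separated_ball_card) auto
    qed
    then have "real (card Z) \<le> real (card (g ` Z)) * b2"
      using finX ZX finite_subset by (intro card_le_fibers) auto
    also have "\<dots> \<le> b1 * b2"
    proof (intro mult_right_mono)
      have "real (card (g ` Z)) \<le> (2 * (ts + w) * DIM('a) / (ts / K) + 2)^DIM('a)"
        using c[OF Zb] tpos assms(5) by simp
      also have "\<dots> \<le> b1"
        unfolding b1_def
      proof (intro power_mono)
        have "2 * (ts + w) * DIM('a) / (ts / K) \<le> 2 * (2 * ts) * DIM('a) / (ts / K)"
          using tw tpos assms by (intro divide_right_mono mult_right_mono) auto
        then show "2 * (ts + w) * DIM('a) / (ts / K) + 2 \<le> 4 * K * DIM('a) + 2"
          using tpos by (simp add: mult_ac)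
      qed (use tpos assms in auto)
      finally show "real (card (g ` Z)) \<le> b1" .
    qed (use b in auto)
    finally show ?thesis by (simp add: Z_def)
  qed
  have "pat ` X \<subseteq> PiE D (\<lambda>_. {..<k})" using ch by (auto simp: pat_def)
  then have "card (pat ` X) \<le> card (PiE D (\<lambda>_. {..<k}))"
    using assms(3) by (intro card_mono finite_PiE) auto
  then have col: "real (card (pat ` X)) \<le> real (k ^ card D)"
    using assms(3) by (simp add: card_PiE flip: of_nat_power)
  have "real (card X) \<le> real (card (pat ` X)) * (b1 * b2)" by (rule card_le_fibers[OF finX fib])
  also have "\<dots> \<le> real (k ^ card D) * (b1 * b2)" using col b by (intro mult_right_mono) auto
  also have "\<dots> \<le> real (k ^ card D) * (b1 * ((2 * K * DIM('a) + 2)^DIM('a) * w^DIM('a)))"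
  proof -
    have "b2 \<le> ((2 * K * DIM('a) + 2) * w)^DIM('a)" unfolding b2_def
      using assms by (intro power_mono) (auto simp: algebra_simps)
    then show ?thesis using b by (intro mult_left_mono) (auto simp: power_mult_distrib)
  qed
  finally show ?thesis by (simp add: X_def b1_def fiber_bound_def mult_ac)
qed

text \<open>\<open>D\<close> is determined by the \<open>m - card F\<close> elements of
  \<open>D - F\<close>.\<close>

lemma card_supersets_le:
  assumes "finite S" "F \<subseteq> S" "card F \<le> m"
  shows "card {D. F \<subseteq> D \<and> D \<subseteq> S \<and> card D = m} \<le> card S ^ (m - card F)"
proof -
  have finF: "finite F" using assms finite_subset by auto
  define j where "j = m - card F"
  have inj: "inj_on (\<lambda>D. D - F) {D. F \<subseteq> D \<and> D \<subseteq> S \<and> card D = m}"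
    by (rule inj_onI) blast
  have "(\<lambda>D. D - F) ` {D. F \<subseteq> D \<and> D \<subseteq> S \<and> card D = m} \<subseteq> {X. X \<subseteq> S \<and> card X = j}"
    using finF by (auto simp: j_def card_Diff_subset)
  then have "card ((\<lambda>D. D - F) ` {D. F \<subseteq> D \<and> D \<subseteq> S \<and> card D = m}) \<le> card {X. X \<subseteq> S \<and> card X = j}"
    using assms(1) by (intro card_mono) auto
  then have "card {D. F \<subseteq> D \<and> D \<subseteq> S \<and> card D = m} \<le> card S choose j"
    using card_image[OF inj] n_subsets[OF assms(1), of j] by simp
  also have "\<dots> \<le> card S ^ j"
    by (cases "j \<le> card S") (auto simp: binomial_le_pow binomial_eq_0)
  finally show ?thesis by (simp add: j_def)
qed

text \<open>If every member \<open>C\<close> failed, it would be determined by a set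
  \<open>D = C - {v}\<close> containing \<open>F\<close> and by one of the few vertices
  \<open>v\<close> without a companion for \<open>D\<close>. There are too few such pairs. Fixing
  \<open>F\<close>, later either an edge or empty, saves the factor
  \<open>card S ^ card F\<close>.\<close>

lemma good_clique_exists:
  fixes S F :: "'a::euclidean_space set" and \<C> :: "'a set set"
  assumes "separated S" "finite S" "F \<subseteq> S" "card F < m" "m \<ge> 2" "w \<ge> 1" "K \<ge> 1"
    and fam: "\<And>C. C \<in> \<C> \<Longrightarrow> F \<subseteq> C \<and> C \<subseteq> S \<and> card C = m"
    and dist: "\<And>C x y. C \<in> \<C> \<Longrightarrow> x \<in> C \<Longrightarrow> y \<in> C \<Longrightarrow> x \<noteq> y \<Longrightarrow>
        2 * w \<le> dist x y \<and> (\<exists>i<k. t i \<le> dist x y \<and> dist x y \<le> t i + w)"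
    and many: "real (card S)^(m - 1 - card F) * (fiber_bound TYPE('a) k (m - 1) K * w^DIM('a)) < real (card \<C>)"
  shows "\<exists>C\<in>\<C>. \<forall>v\<in>C-F. \<exists>v'\<in>S. companion k t w K (C - {v}) v v'"
proof (rule ccontr)
  assume no: "\<not> ?thesis"
  define \<D> where "\<D> = {D. F \<subseteq> D \<and> D \<subseteq> S \<and> card D = m - 1}"
  define bad where "bad D = {v\<in>S. (\<forall>u\<in>D. 2 * w \<le> dist v u \<and> (\<exists>i<k. t i \<le> dist v u \<and> dist v u \<le> t i + w)) \<and>
             \<not> (\<exists>v'\<in>S. companion k t w K D v v')}" for D
  have finD: "finite \<D>" by (rule finite_subset[of _ "Pow S"]) (auto simp: \<D>_def assms)
  have finb: "finite (bad D)" for D using assms(2) by (simp add: bad_def)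
  have "\<C> \<subseteq> (\<Union>D\<in>\<D>. (\<lambda>v. insert v D) ` bad D)"
  proof
    fix C assume C: "C \<in> \<C>"
    then obtain v where v: "v \<in> C" "v \<notin> F" "\<not> (\<exists>v'\<in>S. companion k t w K (C - {v}) v v')"
      using no by blast
    have finC: "finite C" using fam[OF C] assms(2) finite_subset by auto
    have "C - {v} \<in> \<D>" using fam[OF C] v finC by (auto simp: \<D>_def)
    moreover have "v \<in> bad (C - {v})" using v dist[OF C v(1)] fam[OF C] by (auto simp: bad_def)
    moreover have "C = insert v (C - {v})" using v by auto
    ultimately show "C \<in> (\<Union>D\<in>\<D>. (\<lambda>v. insert v D) ` bad D)" by blast
  qed
  then have "card \<C> \<le> card (\<Union>D\<in>\<D>. (\<lambda>v. insert v D) ` bad D)"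
    using finD finb by (intro card_mono) auto
  also have "\<dots> \<le> (\<Sum>D\<in>\<D>. card ((\<lambda>v. insert v D) ` bad D))" by (rule card_UN_le[OF finD])
  also have "\<dots> \<le> (\<Sum>D\<in>\<D>. card (bad D))" using finb by (intro sum_mono card_image_le)
  finally have "real (card \<C>) \<le> (\<Sum>D\<in>\<D>. real (card (bad D)))" by (metis of_nat_le_iff of_nat_sum)
  also have "\<dots> \<le> (\<Sum>D\<in>\<D>. fiber_bound TYPE('a) k (m - 1) K * w^DIM('a))"
  proof (intro sum_mono)
    fix D assume "D \<in> \<D>"
    then have D: "finite D" "D \<noteq> {}" "card D = m - 1"
      using assms(2,5) finite_subset by (auto simp: \<D>_def)
    show "real (card (bad D)) \<le> fiber_bound TYPE('a) k (m - 1) K * w^DIM('a)"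
      using card_without_companion[OF assms(1,2) D(1,2) assms(6,7), of k t] D(3)
      by (simp add: bad_def)
  qed
  also have "\<dots> = real (card \<D>) * (fiber_bound TYPE('a) k (m - 1) K * w^DIM('a))" by simp
  also have "\<dots> \<le> real (card S)^(m - 1 - card F) * (fiber_bound TYPE('a) k (m - 1) K * w^DIM('a))"
  proof (intro mult_right_mono)
    show "real (card \<D>) \<le> real (card S)^(m - 1 - card F)"
      using card_supersets_le[OF assms(2,3), of "m - 1"] assms(4) by (simp add: \<D>_def flip: of_nat_power)
  qed (use assms in \<open>auto simp: fiber_bound_def\<close>)
  finally show False using many by simp
qed

section \<open>From cliques to almost flat sets\<close>

text \<open>The orthogonal projection \<open>w\<close> of \<open>y\<close> to the hyperplane
  satisfies \<open>cos \<beta> * norm y \<le> norm w\<close>, so its angle with \<open>y\<close> is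
  at most \<open>\<beta>\<close>, and the infimum is no larger. Since \<open>\<beta> \<le> 1\<close>
  lies below \<open>pi / 2\<close>, the projection is nonzero.\<close>

lemma plane_angle_hyperplane_le:
  fixes y n :: "'a::euclidean_space"
  assumes "n \<noteq> 0" "y \<noteq> 0" "0 < \<beta>" "\<beta> \<le> 1" "\<bar>y \<bullet> n\<bar> \<le> sin \<beta> * (norm y * norm n)"
  shows "plane_angle y {x. n \<bullet> x = 0} \<le> \<beta>"
proof -
  define w where "w = y - ((y \<bullet> n) / (n \<bullet> n)) *\<^sub>R n"
  have wn: "w \<bullet> n = 0" using assms(1) by (simp add: w_def inner_diff_left)
  have yw: "y \<bullet> w = (norm w)^2"
  proof -
    have "y = w + ((y \<bullet> n) / (n \<bullet> n)) *\<^sub>R n" by (simp add: w_def)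
    then have "y \<bullet> w = w \<bullet> w + ((y \<bullet> n) / (n \<bullet> n)) * (n \<bullet> w)"
      by (metis inner_add_left inner_scaleR_left)
    then show ?thesis using wn by (simp add: inner_commute power2_norm_eq_inner)
  qed
  have "1 < pi / 2" using pi_gt3 by simp
  then have cosb: "cos \<beta> > 0" using assms by (intro cos_gt_zero_pi) auto
  have "(norm w)^2 = (norm y)^2 - (y \<bullet> n)^2 / (norm n)^2"
    using yw by (simp add: w_def inner_diff_right power2_norm_eq_inner power2_eq_square[of "y \<bullet> n"])
  moreover have "(y \<bullet> n)^2 \<le> (sin \<beta>)^2 * (norm y)^2 * (norm n)^2"
    using power_mono[OF assms(5), of 2] by (simp add: power_mult_distrib mult_ac)
  then have "(y \<bullet> n)^2 / (norm n)^2 \<le> (sin \<beta>)^2 * (norm y)^2"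
    using assms(1) by (simp add: divide_le_eq)
  ultimately have "(norm y)^2 - (sin \<beta>)^2 * (norm y)^2 \<le> (norm w)^2" by linarith
  then have "(cos \<beta> * norm y)^2 \<le> (norm w)^2"
    by (simp add: cos_squared_eq power_mult_distrib algebra_simps)
  then have wy: "cos \<beta> * norm y \<le> norm w" by (rule power2_le_imp_le) simp
  moreover have "0 < cos \<beta> * norm y" using cosb assms(2) by simp
  ultimately have "0 < norm w" by linarith
  then have w0: "w \<noteq> 0" by simp
  \<comment> \<open>This keeps the arguments of \<open>arccos\<close> in its domain, also for zero
    vectors, where the quotient is 0 by convention. Hence the angles are bounded below and their
    \<open>Inf\<close> is a lower bound.\<close>
  have quot: "-1 \<le> (u \<bullet> v) / (norm u * norm v) \<and> (u \<bullet> v) / (norm u * norm v) \<le> 1" for u v :: 'a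
  proof -
    have "\<bar>(u \<bullet> v) / (norm u * norm v)\<bar> \<le> 1"
      using Cauchy_Schwarz_ineq2[of u v]
      by (cases "u = 0 \<or> v = 0") (auto simp: abs_divide abs_mult divide_le_eq_1 zero_less_mult_iff)
    then show ?thesis by linarith
  qed
  have "vec_angle y w = arccos ((norm w) / norm y)"
    using yw w0 by (simp add: vec_angle_def power2_eq_square)
  also have "\<dots> \<le> arccos (cos \<beta>)"
  proof (rule arccos_le_arccos)
    show "cos \<beta> \<le> norm w / norm y" using wy assms(2) by (simp add: le_divide_eq)
    show "norm w / norm y \<le> 1" using quot[of y w] yw w0 by (simp add: power2_eq_square)
  qed simp
  also have "\<dots> = \<beta>" using assms pi_gt3 by (intro arccos_cos) auto
  finally have "vec_angle y w \<le> \<beta>" .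
  moreover have "plane_angle y {x. n \<bullet> x = 0} \<le> vec_angle y w"
    unfolding plane_angle_def
  proof (rule cInf_lower)
    show "bdd_below {vec_angle y w |w. w \<in> {x - z |x z. x \<in> {x. n \<bullet> x = 0} \<and> z \<in> {x. n \<bullet> x = 0}} \<and> w \<noteq> 0}"
      using quot by (intro bdd_belowI[of _ 0]) (auto simp: vec_angle_def arccos_lbound)
    have "w = w - 0" "w \<in> {x. n \<bullet> x = 0}" "0 \<in> {x. n \<bullet> x = 0}"
      using wn by (simp_all add: inner_commute)
    then have "w \<in> {x - z |x z. x \<in> {x. n \<bullet> x = 0} \<and> z \<in> {x. n \<bullet> x = 0}}" by blast
    then show "vec_angle y w \<in> {vec_angle y w |w. w \<in> {x - z |x z. x \<in> {x. n \<bullet> x = 0} \<and> z \<in> {x. n \<bullet> x = 0}} \<and> w \<noteq> 0}"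
      using w0 by blast
  qed
  ultimately show ?thesis by linarith
qed

text \<open>By the law of cosines: shifting \<open>v\<close> to a companion at the intermediate scale leaves the
  distance to \<open>q\<close> almost unchanged, so the shift is almost orthogonal to \<open>v - q\<close>.\<close>

lemma companion_nearly_orthogonal:
  fixes v v' q :: "'a::euclidean_space"
  assumes "companion k t w K D v v'" "q \<in> D" "w > 0" "K \<ge> 1"
  shows "\<bar>(v - q) \<bullet> (v - v')\<bar> \<le> 2 / K * (norm (v - q) * norm (v - v'))"
proof -
  define y n where "y = norm (v - q)" and "n = norm (v - v')"
  define y' where "y' = norm (v' - q)"
  have Kw: "K * w \<le> n" and Kn: "K * n \<le> y" and yy: "\<bar>y - y'\<bar> \<le> w"
    using assms(1,2) by (auto simp: companion_def common_interval_def y_def n_def y'_def dist_norm)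
  have "v' - q = (v - q) - (v - v')" by simp
  then have "y'^2 = y^2 - 2 * ((v - q) \<bullet> (v - v')) + n^2"
    unfolding y'_def y_def n_def
    by (simp only: power2_norm_eq_inner) (simp add: inner_diff_left inner_diff_right inner_commute)
  then have "2 * ((v - q) \<bullet> (v - v')) = (y - y') * (y + y') + n^2"
    by (simp add: power2_eq_square algebra_simps)
  then have "2 * \<bar>(v - q) \<bullet> (v - v')\<bar> = \<bar>(y - y') * (y + y') + n^2\<bar>" by linarith
  also have "\<dots> \<le> \<bar>y - y'\<bar> * \<bar>y + y'\<bar> + n^2"
    by (metis abs_mult abs_power2 abs_triangle_ineq)
  also have "\<dots> \<le> w * (2 * y + w) + n^2"
    using yy assms(3) by (intro add_right_mono mult_mono) (auto simp: y_def y'_def)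
  finally have main: "2 * \<bar>(v - q) \<bullet> (v - v')\<bar> \<le> 2 * (w * y) + w * w + n * n"
    by (simp add: power2_eq_square algebra_simps)
  have n0: "n \<ge> 0" and y0: "y \<ge> 0" by (auto simp: n_def y_def)
  have wn: "w \<le> n / K" using Kw assms(4) by (simp add: le_divide_eq mult.commute)
  have ny: "n \<le> y / K" using Kn assms(4) by (simp add: le_divide_eq mult.commute)
  have "n / K \<le> n" using assms(4) n0 by (simp add: divide_le_eq mult_le_cancel_left1)
  moreover have "y / K \<le> y" using assms(4) y0 by (simp add: divide_le_eq mult_le_cancel_left1)
  ultimately have wy: "w \<le> y" using wn ny by linarith
  \<comment> \<open>Because \<open>w \<le> n / K\<close> and \<open>n \<le> y / K\<close>, all error
    terms are of order \<open>n * y / K\<close>.\<close>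
  have "w * y \<le> n / K * y" using wn y0 by (rule mult_right_mono)
  moreover have "w * w \<le> n / K * y" using wn wy assms(3) n0 assms(4) by (intro mult_mono) auto
  moreover have "n * n \<le> n / K * y" using mult_left_mono[OF ny n0] by simp
  ultimately have "2 * \<bar>(v - q) \<bullet> (v - v')\<bar> \<le> 4 * (n / K * y)" using main by linarith
  then show ?thesis by (simp add: y_def n_def mult_ac)
qed

section \<open>Rescaling to nearly k-distance sets\<close>

text \<open>\<open>nearly_k_distance\<close> asks for \<open>k\<close> strictly increasing
  parameters, while the distances at hand may be fewer and unordered. They are padded from 1, ...,
  \<open>k\<close> to a set of exactly \<open>k\<close> numbers and sorted.\<close>

lemma strict_params_exist:
  fixes U :: "real set"
  assumes "finite U" "card U \<le> k" "k \<ge> 1" "\<And>u. u \<in> U \<Longrightarrow> 1 \<le> u"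
  obtains t :: "nat \<Rightarrow> real" where "1 \<le> t 0" "\<And>i. Suc i < k \<Longrightarrow> t i < t (Suc i)"
    "\<And>u. u \<in> U \<Longrightarrow> \<exists>i<k. t i = u"
proof -
  have "card (real ` {1..k}) = k" by (simp add: card_image)
  then have "k \<le> card (U \<union> real ` {1..k})"
    using assms(1) by (metis card_mono finite_UnI finite_atLeastAtMost finite_imageI sup_ge2)
  then obtain U' where U': "U \<subseteq> U'" "U' \<subseteq> U \<union> real ` {1..k}" "card U' = k"
    using exists_subset_between[of U k "U \<union> real ` {1..k}"] assms(1,2) by auto
  have finU': "finite U'" using U'(2) assms(1) finite_subset by fastforce
  have ge1: "1 \<le> u" if "u \<in> U'" for u using that U'(2) assms(4) by auto
  define l where "l = sorted_list_of_set U'"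
  have l: "set l = U'" "length l = k" "sorted_wrt (<) l"
    using finU' U'(3) by (auto simp: l_def)
  show ?thesis
  proof
    show "1 \<le> l ! 0" using ge1 l assms(3) nth_mem[of 0 l] by auto
    show "l ! i < l ! Suc i" if "Suc i < k" for i using l that by (simp add: sorted_wrt_nth_less)
    show "\<exists>i<k. l ! i = u" if "u \<in> U" for u using that U'(1) l by (metis in_set_conv_nth subsetD)
  qed
qed

text \<open>Scaling by \<open>1 / \<sigma>\<close> turns the widths
  \<open>\<epsilon> * \<sigma>\<close> into \<open>\<epsilon>\<close> and the lower bound
  \<open>\<sigma>\<close> into 1, which also yields separation. Angles do not change, so flatness
  follows from near orthogonality to a normal vector before scaling. \<open>X\<close> holds the
  exceptional points.\<close>

lemma rescaled_flat_set:
  fixes Q :: "'a::euclidean_space set"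
  assumes "DIM('a) \<ge> 2" "finite Q" "\<sigma> > 0" "\<epsilon> > 0" "0 < \<beta>" "\<beta> \<le> 1" "\<beta> \<le> \<alpha>"
    and U: "finite U" "card U \<le> k" "k \<ge> 1" "\<And>u. u \<in> U \<Longrightarrow> \<sigma> \<le> u"
    and dist: "\<And>x y. x \<in> Q \<Longrightarrow> y \<in> Q \<Longrightarrow> x \<noteq> y \<Longrightarrow> \<exists>u\<in>U. u \<le> dist x y \<and> dist x y \<le> u + \<epsilon> * \<sigma>"
    and X: "finite X" "card X \<le> 2"
    and flat: "\<And>v. v \<in> Q - X \<Longrightarrow> \<exists>n. n \<noteq> 0 \<and> (\<forall>q\<in>Q. q \<noteq> v \<longrightarrow> \<bar>(v - q) \<bullet> n\<bar> \<le> sin \<beta> * (norm (v - q) * norm n))"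
  shows "\<exists>P::'a set. finite P \<and> card P = card Q \<and> almost_flat (DIM('a) - 1) \<alpha> P \<and> nearly_k_distance k \<epsilon> P"
proof -
  define f where "f x = (1 / \<sigma>) *\<^sub>R x" for x :: 'a
  have inj: "inj f" using assms(3) by (auto simp: inj_on_def f_def)
  have df: "dist (f x) (f y) = dist x y / \<sigma>" for x y
    using assms(3) by (simp add: f_def dist_norm flip: scaleR_diff_right)
  define P where "P = f ` Q"
  have "finite P" "card P = card Q" using assms(2) inj by (auto simp: P_def card_image inj_on_subset)
  moreover have "nearly_k_distance k \<epsilon> P"
  proof -
    have U1: "1 \<le> u" if "u \<in> (\<lambda>u. u / \<sigma>) ` U" for u using that U(4) assms(3) by auto
    have "card ((\<lambda>u. u / \<sigma>) ` U) \<le> k" using U card_image_le le_trans by blast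
    then obtain t :: "nat \<Rightarrow> real" where t: "1 \<le> t 0" "\<And>i. Suc i < k \<Longrightarrow> t i < t (Suc i)"
      "\<And>u. u \<in> (\<lambda>u. u / \<sigma>) ` U \<Longrightarrow> \<exists>i<k. t i = u"
      using strict_params_exist[of "(\<lambda>u. u / \<sigma>) ` U" k] U1 U by blast
    have ex: "\<exists>i<k. t i \<le> dist p q \<and> dist p q \<le> t i + \<epsilon> \<and> 1 \<le> t i"
      if "p \<in> P" "q \<in> P" "p \<noteq> q" for p q
    proof -
      obtain x y where xy: "x \<in> Q" "y \<in> Q" "p = f x" "q = f y" using \<open>p \<in> P\<close> \<open>q \<in> P\<close> by (auto simp: P_def)
      then have "x \<noteq> y" using that by auto
      then obtain u where u: "u \<in> U" "u \<le> dist x y" "dist x y \<le> u + \<epsilon> * \<sigma>" using dist xy by blast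
      obtain i where i: "i < k" "t i = u / \<sigma>" using t(3)[of "u / \<sigma>"] u(1) by auto
      moreover have "t i \<le> dist p q" using u assms(3) by (simp add: i xy df divide_right_mono)
      moreover have "dist p q \<le> t i + \<epsilon>"
        using u(3) assms(3) by (simp add: i xy df field_simps)
      moreover have "1 \<le> t i" unfolding i using U1 u(1) by blast
      ultimately show ?thesis by blast
    qed
    then have "separated P" unfolding separated_def by (meson order_trans)
    moreover have "1 \<le> t 0 \<and> (\<forall>i. Suc i < k \<longrightarrow> t i < t (Suc i)) \<and>
        (\<forall>p\<in>P. \<forall>q\<in>P. p \<noteq> q \<longrightarrow> (\<exists>i<k. t i \<le> dist p q \<and> dist p q \<le> t i + \<epsilon>))"
      using t(1,2) ex by blast
    ultimately show ?thesis unfolding nearly_k_distance_def by blast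
  qed
  moreover have "almost_flat (DIM('a) - 1) \<alpha> P"
  proof -
    have "flat_at P (f v) (DIM('a) - 1) \<alpha>" if v: "v \<in> Q - X" for v
    proof -
      obtain n where n: "n \<noteq> 0" "\<forall>q\<in>Q. q \<noteq> v \<longrightarrow> \<bar>(v - q) \<bullet> n\<bar> \<le> sin \<beta> * (norm (v - q) * norm n)"
        using flat[OF v] by blast
      have "is_plane (DIM('a) - 1) {x. n \<bullet> x = 0}"
        unfolding is_plane_def using aff_dim_hyperplane[OF n(1), of 0] n(1) assms(1)
        by (auto simp: affine_hyperplane of_nat_diff intro!: exI[of _ 0])
      moreover have "plane_angle (f v - p) {x. n \<bullet> x = 0} \<le> \<alpha>" if p: "p \<in> P" "p \<noteq> f v" for p
      proof -
        obtain q where q: "q \<in> Q" "p = f q" using p by (auto simp: P_def)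
        then have qv: "q \<noteq> v" using p by auto
        have e: "f v - p = (1 / \<sigma>) *\<^sub>R (v - q)" by (simp add: q f_def scaleR_diff_right)
        have "\<bar>(f v - p) \<bullet> n\<bar> = \<bar>(v - q) \<bullet> n\<bar> / \<sigma>" using assms(3) by (simp add: e abs_divide abs_mult)
        also have "\<dots> \<le> sin \<beta> * (norm (v - q) * norm n) / \<sigma>"
          using n(2) q(1) qv assms(3) by (intro divide_right_mono) auto
        also have "\<dots> = sin \<beta> * (norm (f v - p) * norm n)" using assms(3) by (simp add: e)
        finally have "plane_angle (f v - p) {x. n \<bullet> x = 0} \<le> \<beta>"
          using n(1) p assms by (intro plane_angle_hyperplane_le) auto
        then show ?thesis using assms by linarith
      qed
      ultimately show ?thesis unfolding flat_at_def by blast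
    qed
    then have "{p \<in> P. \<not> flat_at P p (DIM('a) - 1) \<alpha>} \<subseteq> f ` X" by (auto simp: P_def)
    then have "card {p \<in> P. \<not> flat_at P p (DIM('a) - 1) \<alpha>} \<le> card (f ` X)"
      using X(1) by (intro card_mono) auto
    also have "\<dots> \<le> 2" using X card_image_le le_trans by blast
    finally show ?thesis by (simp add: almost_flat_def)
  qed
  ultimately show ?thesis by blast
qed

text \<open>With \<open>\<sigma> = w / \<epsilon>\<close> the width \<open>w\<close> becomes
  \<open>\<epsilon>\<close>, and all parameters are at least \<open>K * w\<close>, hence at least
  \<open>\<sigma>\<close>. The normal at \<open>v\<close> is its shift \<open>v - v'\<close> to a
  companion; the at most two points of \<open>F\<close> are the exceptions.\<close>

lemma flat_set_of_clique:
  fixes C F :: "'a::euclidean_space set"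
  assumes "DIM('a) \<ge> 2" "k \<ge> 1" "finite C" "F \<subseteq> C" "card F \<le> 2"
    and "\<epsilon> > 0" "0 < \<beta>" "\<beta> \<le> 1" "\<beta> \<le> \<alpha>" "w > 0" "K \<ge> 1" "1 / \<epsilon> \<le> K" "2 / K \<le> sin \<beta>"
    and "\<And>i. i < k \<Longrightarrow> K * w \<le> t i"
    and dist: "\<And>x y. x \<in> C \<Longrightarrow> y \<in> C \<Longrightarrow> x \<noteq> y \<Longrightarrow> \<exists>i<k. t i \<le> dist x y \<and> dist x y \<le> t i + w"
    and comp: "\<And>v. v \<in> C - F \<Longrightarrow> \<exists>v'. companion k t w K (C - {v}) v v'"
  shows "\<exists>P::'a set. finite P \<and> card P = card C \<and> almost_flat (DIM('a) - 1) \<alpha> P \<and> nearly_k_distance k \<epsilon> P"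
proof (rule rescaled_flat_set[where \<sigma> = "w / \<epsilon>" and U = "t ` {..<k}" and X = F and \<beta> = \<beta>])
  show "card (t ` {..<k}) \<le> k" using card_image_le[of "{..<k}" t] by simp
  show "w / \<epsilon> \<le> u" if "u \<in> t ` {..<k}" for u
  proof -
    have "w / \<epsilon> \<le> K * w" using mult_right_mono[OF assms(12), of w] assms(10) by simp
    then show ?thesis using that assms(14) by force
  qed
  show "\<exists>u\<in>t ` {..<k}. u \<le> dist x y \<and> dist x y \<le> u + \<epsilon> * (w / \<epsilon>)"
    if "x \<in> C" "y \<in> C" "x \<noteq> y" for x y
    using dist[OF that] assms(6) by auto
  show "finite F" using assms(3,4) finite_subset by auto
  show "\<exists>n. n \<noteq> 0 \<and> (\<forall>q\<in>C. q \<noteq> v \<longrightarrow> \<bar>(v - q) \<bullet> n\<bar> \<le> sin \<beta> * (norm (v - q) * norm n))"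
    if v: "v \<in> C - F" for v
  proof -
    obtain v' where v': "companion k t w K (C - {v}) v v'" using comp[OF v] by blast
    have "0 < K * w" using assms by simp
    then have "v - v' \<noteq> 0" using v' by (auto simp: companion_def)
    moreover have "\<bar>(v - q) \<bullet> (v - v')\<bar> \<le> sin \<beta> * (norm (v - q) * norm (v - v'))"
      if "q \<in> C" "q \<noteq> v" for q
    proof -
      have "\<bar>(v - q) \<bullet> (v - v')\<bar> \<le> 2 / K * (norm (v - q) * norm (v - v'))"
        using companion_nearly_orthogonal[OF v'] that assms by auto
      also have "\<dots> \<le> sin \<beta> * (norm (v - q) * norm (v - v'))"
        using assms(13) by (rule mult_right_mono) auto
      finally show ?thesis .
    qed
    ultimately show ?thesis by blast
  qed
qed (use assms in auto)

text \<open>When the smallest distance \<open>t 0\<close> is not used by \<open>C\<close>, it can be replaced by the distance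
  of one vertex to its companion, which gains a point.\<close>

lemma flat_set_of_clique_and_companion:
  fixes C :: "'a::euclidean_space set"
  assumes "DIM('a) \<ge> 2" "k \<ge> 1" "finite C" "C \<noteq> {}"
    and "\<epsilon> > 0" "0 < \<beta>" "\<beta> \<le> 1" "\<beta> \<le> \<alpha>" "w > 0" "K \<ge> 2" "1 / \<epsilon> \<le> K" "6 / K \<le> sin \<beta>"
    and "t 0 < K * w"
    and dist: "\<And>x y. x \<in> C \<Longrightarrow> y \<in> C \<Longrightarrow> x \<noteq> y \<Longrightarrow>
        2 * (K * w) < dist x y \<and> (\<exists>i<k. t i \<le> dist x y \<and> dist x y \<le> t i + w)"
    and comp: "\<And>v. v \<in> C \<Longrightarrow> \<exists>v'. companion k t w K (C - {v}) v v'"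
  shows "\<exists>P::'a set. finite P \<and> card P = Suc (card C) \<and> almost_flat (DIM('a) - 1) \<alpha> P \<and> nearly_k_distance k \<epsilon> P"
proof -
  obtain a where a: "a \<in> C" using assms(4) by auto
  obtain a' where a': "companion k t w K (C - {a}) a a'" using comp[OF a] by blast
  have wK: "w \<le> K * w" using assms by simp
  have aa: "K * w \<le> dist a a'" using a' by (simp add: companion_def)
  have ab: "K * dist a a' \<le> dist a b" "common_interval k t w (dist a b) (dist a' b)"
    if "b \<in> C" "b \<noteq> a" for b
    using a' that by (auto simp: companion_def)
  have half: "dist a b \<le> 2 * dist a' b" "0 < dist a' b" if "b \<in> C" "b \<noteq> a" for b
  proof -
    have "2 * dist a a' \<le> K * dist a a'" using assms(10) by (intro mult_right_mono) auto
    then have "2 * dist a a' \<le> dist a b" using ab(1)[OF that] by linarith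
    then show "dist a b \<le> 2 * dist a' b" using dist_triangle[of a b a'] by linarith
    then show "0 < dist a' b" using dist[OF a, of b] that wK assms(9) by auto
  qed
  have aC: "a' \<notin> C"
  proof
    assume "a' \<in> C"
    moreover have "0 < dist a a'" using aa wK assms(9) by linarith
    then have "a' \<noteq> a" by auto
    ultimately show False using half(2) by force
  qed
  \<comment> \<open>Distances in \<open>C\<close> exceed \<open>2 * (K * w)\<close>, so their left
    endpoints are at least \<open>K * w\<close> and differ from \<open>t 0\<close>. Omitting index 0
    makes room for \<open>dist a a'\<close> among the \<open>k\<close> parameters.\<close>
  define U where "U = insert (dist a a') (t ` {i. 1 \<le> i \<and> i < k \<and> K * w \<le> t i})"
  have large: "\<exists>u\<in>U. u \<le> x \<and> x \<le> u + w \<and> u \<le> y \<and> y \<le> u + w"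
    if xy: "common_interval k t w x y" "2 * (K * w) < x" for x y
  proof -
    obtain i where i: "i < k" "t i \<le> x" "x \<le> t i + w" "t i \<le> y" "y \<le> t i + w"
      using xy(1) by (auto simp: common_interval_def)
    have "K * w \<le> t i" using i xy(2) wK by linarith
    moreover from this have "1 \<le> i" using assms(13) by (cases i) auto
    ultimately show ?thesis using i by (auto simp: U_def)
  qed
  have "\<exists>P::'a set. finite P \<and> card P = card (insert a' C) \<and> almost_flat (DIM('a) - 1) \<alpha> P \<and> nearly_k_distance k \<epsilon> P"
  proof (rule rescaled_flat_set[where \<sigma> = "w / \<epsilon>" and U = U and X = "{a, a'}" and \<beta> = \<beta>])
    show "finite U" by (simp add: U_def)
    show "card U \<le> k"
    proof -
      have "card (t ` {i. 1 \<le> i \<and> i < k \<and> K * w \<le> t i}) \<le> card {i. 1 \<le> i \<and> i < k \<and> K * w \<le> t i}"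
        by (intro card_image_le) auto
      also have "\<dots> \<le> card {1..<k}" by (intro card_mono) auto
      finally show ?thesis using assms(2)
        card_insert_le_m1[of k "t ` {i. 1 \<le> i \<and> i < k \<and> K * w \<le> t i}" "dist a a'"]
        by (simp add: U_def)
    qed
    show "w / \<epsilon> \<le> u" if "u \<in> U" for u
    proof -
      have "w / \<epsilon> \<le> K * w" using mult_right_mono[OF assms(11), of w] assms(9) by simp
      then show ?thesis using that aa by (auto simp: U_def)
    qed
    have key: "\<exists>u\<in>U. u \<le> dist x y \<and> dist x y \<le> u + w" if "x \<in> insert a' C" "y \<in> C" "x \<noteq> y" for x y
    proof (cases "x = a'")
      case False
      then have "x \<in> C" using that by auto
      then have "common_interval k t w (dist x y) (dist x y)" "2 * (K * w) < dist x y"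
        using dist[of x y] that by (auto simp: common_interval_def)
      then show ?thesis using large by blast
    next
      case True
      show ?thesis
      proof (cases "y = a")
        case True
        then show ?thesis using \<open>x = a'\<close> assms(9) by (auto simp: U_def dist_commute)
      next
        case False
        then show ?thesis using large[OF ab(2)[OF that(2)]] dist[OF a that(2)] \<open>x = a'\<close> by auto
      qed
    qed
    show "\<exists>u\<in>U. u \<le> dist x y \<and> dist x y \<le> u + \<epsilon> * (w / \<epsilon>)"
      if xy: "x \<in> insert a' C" "y \<in> insert a' C" "x \<noteq> y" for x y
    proof (cases "y \<in> C")
      case True
      then show ?thesis using key[of x y] xy assms(5) by simp
    next
      case False
      then have "\<exists>u\<in>U. u \<le> dist y x \<and> dist y x \<le> u + w" using key[of y x] xy by auto
      then show ?thesis using assms(5) by (simp add: dist_commute)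
    qed
    show "card {a, a'} \<le> 2" by (simp add: card_insert_if)
    show "\<exists>n. n \<noteq> 0 \<and> (\<forall>q\<in>insert a' C. q \<noteq> v \<longrightarrow> \<bar>(v - q) \<bullet> n\<bar> \<le> sin \<beta> * (norm (v - q) * norm n))"
      if v: "v \<in> insert a' C - {a, a'}" for v
    proof -
      have vC: "v \<in> C" "v \<noteq> a" using v by auto
      obtain v' where v': "companion k t w K (C - {v}) v v'" using comp[OF vC(1)] by blast
      have K1: "K \<ge> 1" using assms(10) by simp
      define n where "n = v - v'"
      have "0 < K * w" using assms by simp
      then have "n \<noteq> 0" using v' by (auto simp: companion_def n_def)
      have orth: "\<bar>(v - q) \<bullet> n\<bar> \<le> 2 / K * (norm (v - q) * norm n)" if "q \<in> C" "q \<noteq> v" for q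
        using companion_nearly_orthogonal[OF v' _ assms(9) K1] that by (simp add: n_def)
      have "\<bar>(v - q) \<bullet> n\<bar> \<le> 6 / K * (norm (v - q) * norm n)" if q: "q \<in> insert a' C" "q \<noteq> v" for q
      proof (cases "q = a'")
        case False
        then have "\<bar>(v - q) \<bullet> n\<bar> \<le> 2 / K * (norm (v - q) * norm n)" using q orth by auto
        also have "\<dots> \<le> 6 / K * (norm (v - q) * norm n)"
          using K1 by (intro mult_right_mono divide_right_mono) auto
        finally show ?thesis .
      next
        case True
        \<comment> \<open>The added point is reached through \<open>a\<close>: the shift
          \<open>a - a'\<close> raises the constant from 2 to 3, and comparing \<open>v - a\<close>
          with \<open>v - a'\<close> doubles it. This is the source of \<open>6 / K\<close>.\<close>
        have "(v - a') \<bullet> n = (v - a) \<bullet> n + (a - a') \<bullet> n" by (simp add: inner_diff_left)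
        then have "\<bar>(v - a') \<bullet> n\<bar> \<le> \<bar>(v - a) \<bullet> n\<bar> + \<bar>(a - a') \<bullet> n\<bar>" by linarith
        also have "\<dots> \<le> 2 / K * (norm (v - a) * norm n) + norm (a - a') * norm n"
          using orth[OF a] vC Cauchy_Schwarz_ineq2[of "a - a'" n] by (intro add_mono) auto
        also have "\<dots> \<le> 2 / K * (norm (v - a) * norm n) + 1 / K * norm (v - a) * norm n"
        proof (intro add_left_mono mult_right_mono)
          have "K * norm (a - a') \<le> norm (v - a)"
            using ab(1)[OF vC] by (simp add: dist_norm norm_minus_commute)
          then show "norm (a - a') \<le> 1 / K * norm (v - a)" using K1 by (simp add: le_divide_eq mult.commute)
        qed simp
        also have "\<dots> = 3 / K * (norm (v - a) * norm n)" by (simp add: field_simps)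
        also have "\<dots> \<le> 3 / K * ((2 * norm (v - a')) * norm n)"
          using half(1)[OF vC] K1
          by (intro mult_left_mono mult_right_mono) (auto simp: dist_norm norm_minus_commute)
        finally show ?thesis using True by simp
      qed
      moreover have "6 / K * (norm (v - q) * norm n) \<le> sin \<beta> * (norm (v - q) * norm n)" for q
        using assms(12) by (rule mult_right_mono) auto
      ultimately show ?thesis using \<open>n \<noteq> 0\<close> order_trans by blast
    qed
  qed (use assms in auto)
  then show ?thesis using aC assms(3) by simp
qed

section \<open>The graph of good pairs\<close>

text \<open>The threshold \<open>L\<close> serves to drop short edges; on a set of distinct points,
  \<open>L = 0\<close> keeps all good pairs.\<close>

definition pair_edges :: "nat \<Rightarrow> (nat \<Rightarrow> real) \<Rightarrow> real \<Rightarrow> real \<Rightarrow> 'a::euclidean_space set \<Rightarrow> 'a set set" where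
  "pair_edges k t w L S = {{x, y} | x y. x \<in> S \<and> y \<in> S \<and> x \<noteq> y \<and> L < dist x y \<and>
      (\<exists>i<k. t i \<le> dist x y \<and> dist x y \<le> t i + w)}"

lemma pair_edgesD:
  assumes "{x, y} \<in> pair_edges k t w L S"
  shows "L < dist x y \<and> (\<exists>i<k. t i \<le> dist x y \<and> dist x y \<le> t i + w)"
proof -
  obtain u v where "{x, y} = {u, v}" "L < dist u v" "\<exists>i<k. t i \<le> dist u v \<and> dist u v \<le> t i + w"
    using assms by (auto simp: pair_edges_def)
  then show ?thesis by (auto simp: doubleton_eq_iff dist_commute)
qed

lemma simple_pair_edges: "simple_edges (pair_edges k t w L S)"
  by (auto simp: simple_edges_def pair_edges_def)

lemma edges_in_pair_edges: "edges_in (pair_edges k t w L S) S = pair_edges k t w L S"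
  by (auto simp: edges_in_def pair_edges_def)

lemma finite_pair_edges: "finite S \<Longrightarrow> finite (pair_edges k t w L S)"
  by (rule finite_subset[of _ "Pow S"]) (auto simp: pair_edges_def)

lemma good_pairs_eq: "good_pairs k t w S = card (pair_edges k t w 0 S)"
  unfolding good_pairs_def pair_edges_def by (intro arg_cong[of _ _ card] Collect_cong) auto

lemma good_pairs_mono:
  assumes "finite S" "w \<le> w'"
  shows "good_pairs k t w S \<le> good_pairs k t w' S"
  unfolding good_pairs_eq
proof (intro card_mono finite_pair_edges assms)
  show "pair_edges k t w 0 S \<subseteq> pair_edges k t w' 0 S"
    using assms(2) unfolding pair_edges_def by (smt (verit, ccfv_threshold) mem_Collect_eq subsetI)
qed

text \<open>By packing, each point has at most \<open>(2 * L * DIM('a) + 2)^DIM('a)\<close> points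
  of \<open>S\<close> within distance \<open>L\<close>. For \<open>L\<close> proportional to
  \<open>w\<close> this is a small multiple of \<open>n\<close> once \<open>c\<close> is
  small.\<close>

lemma card_short_pairs:
  fixes S :: "'a::euclidean_space set"
  assumes "separated S" "finite S" "L \<ge> 0"
  shows "real (card (pair_edges k t w 0 S))
    \<le> real (card (pair_edges k t w L S)) + real (card S) * (2 * L * DIM('a) + 2)^DIM('a)"
proof -
  define N where "N x = {y\<in>S. dist x y \<le> L}" for x
  have finN: "finite (N x)" for x using assms(2) by (simp add: N_def)
  have "pair_edges k t w 0 S \<subseteq> pair_edges k t w L S \<union> (\<lambda>(x, y). {x, y}) ` (SIGMA x:S. N x)"
  proof
    fix e assume "e \<in> pair_edges k t w 0 S"
    then obtain x y where xy: "e = {x, y}" "x \<in> S" "y \<in> S" "x \<noteq> y"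
      "\<exists>i<k. t i \<le> dist x y \<and> dist x y \<le> t i + w" by (auto simp: pair_edges_def)
    show "e \<in> pair_edges k t w L S \<union> (\<lambda>(x, y). {x, y}) ` (SIGMA x:S. N x)"
    proof (cases "dist x y \<le> L")
      case True
      then have "(x, y) \<in> (SIGMA x:S. N x)" using xy by (simp add: N_def)
      then show ?thesis using xy(1) by (metis (no_types, lifting) UnI2 case_prod_conv image_eqI)
    next
      case False
      then show ?thesis using xy unfolding pair_edges_def by force
    qed
  qed
  then have "card (pair_edges k t w 0 S) \<le> card (pair_edges k t w L S \<union> (\<lambda>(x, y). {x, y}) ` (SIGMA x:S. N x))"
    using assms(2) finN finite_pair_edges by (intro card_mono) auto
  also have "\<dots> \<le> card (pair_edges k t w L S) + card ((\<lambda>(x, y). {x, y}) ` (SIGMA x:S. N x))"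
    by (rule card_Un_le)
  also have "\<dots> \<le> card (pair_edges k t w L S) + card (SIGMA x:S. N x)"
    using assms(2) finN by (intro add_left_mono card_image_le) auto
  also have "card (SIGMA x:S. N x) = (\<Sum>x\<in>S. card (N x))" using assms(2) finN by simp
  finally have "real (card (pair_edges k t w 0 S)) \<le> real (card (pair_edges k t w L S)) + (\<Sum>x\<in>S. real (card (N x)))"
    by (metis of_nat_add of_nat_le_iff of_nat_sum)
  also have "(\<Sum>x\<in>S. real (card (N x))) \<le> (\<Sum>x\<in>S. (2 * L * DIM('a) + 2)^DIM('a))"
  proof (intro sum_mono separated_ball_card assms(3))
    show "separated (N x)" for x using assms(1) by (auto simp: separated_def N_def)
    show "N x \<subseteq> cball x L" for x by (auto simp: N_def)
  qed
  finally show ?thesis by simp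
qed

text \<open>Treats a single configuration with the wide intervals; both claims on \<open>Mw\<close>
  are derived from it.\<close>

lemma good_pairs_le_turan:
  assumes "DIM('a::euclidean_space) \<ge> 2" "k \<ge> 1"
  shows "\<exists>c>0. \<exists>n0. \<forall>(S::'a set) t. separated S \<longrightarrow> finite S \<longrightarrow> n0 \<le> card S \<longrightarrow> dist_params k t \<longrightarrow>
     good_pairs k t (c * real (card S) powr (1 / real DIM('a))) S \<le> turan (card S) (A TYPE('a) k)"
proof -
  define a where "a = A TYPE('a) k"
  have a2: "a \<ge> 2" using A_maximal(1)[OF assms(2), where 'a = 'a] by (simp add: a_def)
  obtain \<epsilon> \<alpha> :: real where ea: "\<epsilon> > 0" "\<alpha> > 0" and none:
    "\<And>P::'a set. finite P \<Longrightarrow> card P = Suc a \<Longrightarrow> almost_flat (DIM('a) - 1) \<alpha> P \<Longrightarrow> \<not> nearly_k_distance k \<epsilon> P"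
    using A_maximal(2)[OF assms(2), where 'a = 'a] unfolding a_def by blast
  \<comment> \<open>The cap 1 keeps the angle below \<open>pi / 2\<close>.\<close>
  define \<beta> where "\<beta> = min \<alpha> 1"
  have \<beta>: "0 < \<beta>" "\<beta> \<le> 1" "\<beta> \<le> \<alpha>" using ea by (auto simp: \<beta>_def)
  have sb: "sin \<beta> > 0" using \<beta> pi_gt3 by (intro sin_gt_zero) auto
  define K where "K = 2 + 1 / \<epsilon> + 6 / sin \<beta>"
  have pos: "1 / \<epsilon> > 0" "6 / sin \<beta> > 0" using ea sb by auto
  then have K2: "K \<ge> 2" and Keps: "1 / \<epsilon> \<le> K" and "6 / sin \<beta> \<le> K" unfolding K_def by linarith+
  then have K6: "6 / K \<le> sin \<beta>" using sb by (simp add: field_simps)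
  have "2 / K \<le> 6 / K" using K2 by (intro divide_right_mono) auto
  then have K2': "2 / K \<le> sin \<beta>" using K6 by linarith
  have K1: "K \<ge> 1" using K2 by simp
  obtain \<delta>B nB where dB: "\<delta>B > 0" and edgeB:
    "\<And>(E :: 'a set set) V. simple_edges E \<Longrightarrow> finite V \<Longrightarrow> nB \<le> card V \<Longrightarrow>
     card (edges_in E V) > turan (card V) a \<Longrightarrow>
     (\<exists>p\<in>V. \<exists>q\<in>V. p \<noteq> q \<and> {p, q} \<in> E \<and>
        \<delta>B * real (card V)^(a - 1) \<le> real (card {C \<in> cliques E V (Suc a). {p, q} \<subseteq> C}))"
    using edge_in_many_cliques[of a, where 'v = 'a] a2 by (meson zero_less_numeral order_less_le_trans)
  have a1: "a - 1 > 0" and Suca: "Suc (a - 1) = a" using a2 by auto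
  obtain \<delta>A nA where dA: "\<delta>A > 0" and manyA:
    "\<And>(E :: 'a set set) V x. simple_edges E \<Longrightarrow> finite V \<Longrightarrow> nA \<le> card V \<Longrightarrow>
     card (edges_in E V) \<ge> turan (card V) (a - 1) + x \<Longrightarrow>
     real x * \<delta>A * real (card V)^(a - 1 - 1) \<le> real (card (cliques E V a))"
    using many_cliques[OF a1, where 'v = 'a] unfolding Suca by blast
  define \<rho> where "\<rho> = 1 / (4 * real (a - 1) * real a)"
  have \<rho>: "\<rho> > 0" using a1 a2 by (simp add: \<rho>_def)
  define h where "h = ((4 * real DIM('a) + 2) * K)^DIM('a)"
  have h: "h > 0" using K1 by (simp add: h_def)
  define fA where "fA = fiber_bound TYPE('a) k (a - 1) K"
  define fB where "fB = fiber_bound TYPE('a) k a K"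
  have f: "fA \<ge> 0" "fB \<ge> 0" using K1 by (auto simp: fA_def fB_def fiber_bound_def)
  \<comment> \<open>The entries ensure, in turn, that \<open>c^DIM('a) \<le> c\<close>, that the
    short edges use at most half of the gap between the Turan numbers, and that the cliques
    outnumber those with a companionless vertex in each of the two cases.\<close>
  define c where "c = min 1 (min (\<rho> / 2 / h) (min (\<rho> / 4 * \<delta>A / (fA + 1)) (\<delta>B / (fB + 1))))"
  have c0: "c > 0" using \<rho> h f dA dB by (auto simp: c_def)
  have c1: "c \<le> 1" and c2: "c \<le> \<rho> / 2 / h" and c3: "c \<le> \<rho> / 4 * \<delta>A / (fA + 1)"
    and c4: "c \<le> \<delta>B / (fB + 1)" by (auto simp: c_def)
  define cd where "cd = c ^ DIM('a)"
  have cd0: "cd > 0" using c0 by (simp add: cd_def)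
  have cdc: "cd \<le> c" using power_decreasing[of 1 "DIM('a)" c] c0 c1 assms(1) by (simp add: cd_def)
  \<comment> \<open>The denominator \<open>f + 1\<close> makes the inequality strict and allows
    \<open>f = 0\<close>.\<close>
  have lt: "f * cd < D" if "f \<ge> 0" "D > 0" "c \<le> D / (f + 1)" for f D
  proof -
    have "f * cd \<le> f * (D / (f + 1))" using cdc that by (intro mult_left_mono) auto
    also have "\<dots> < D" using that by (simp add: field_simps)
    finally show ?thesis .
  qed
  have ltA: "fA * cd < \<rho> / 4 * \<delta>A" by (rule lt[OF f(1) _ c3]) (use \<rho> dA in simp)
  have ltB: "fB * cd < \<delta>B" by (rule lt[OF f(2) dB c4])
  have lth: "h * cd \<le> \<rho> / 2"
    using mult_left_mono[OF order_trans[OF cdc c2], of h] h by simp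
  \<comment> \<open>Besides the thresholds of the clique counts and of \<open>turan_gap\<close>,
    \<open>1 / cd\<close> gives \<open>w \<ge> 1\<close> and \<open>4 / \<rho>\<close> makes the
    rounding in \<open>x\<close> harmless.\<close>
  define n0 where "n0 = Max {nA, nB, 2 * (a - 1) * a, 1, nat \<lceil>1 / cd\<rceil>, nat \<lceil>4 / \<rho>\<rceil>}"
  have "good_pairs k t (c * real (card S) powr (1 / real DIM('a))) S \<le> turan (card S) a"
    if S: "separated S" "finite S" "n0 \<le> card S" "dist_params k t" for S :: "'a set" and t
  proof (rule ccontr)
    define n where "n = card S"
    define w where "w = c * real n powr (1 / real DIM('a))"
    have nbig: "nA \<le> n" "nB \<le> n" "2 * (a - 1) * a \<le> n" "1 \<le> n" "nat \<lceil>1 / cd\<rceil> \<le> n" "nat \<lceil>4 / \<rho>\<rceil> \<le> n"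
      using S(3) by (auto simp: n0_def n_def)
    have rn: "real n \<ge> 1" "1 / cd \<le> real n" "4 / \<rho> \<le> real n" using nbig by linarith+
    \<comment> \<open>The exponent makes \<open>w^DIM('a)\<close> linear in \<open>n\<close>, with
      the small factor \<open>cd\<close>. This is the order of magnitude at which the packing bounds
      still lose against the clique counts.\<close>
    have "(real n powr (1 / real DIM('a)))^DIM('a) = real n"
      using rn(1) by (simp add: powr_power)
    then have wd: "w^DIM('a) = cd * real n" by (simp add: w_def cd_def power_mult_distrib)
    have "w \<ge> 1"
    proof (rule ccontr)
      assume "\<not> w \<ge> 1"
      moreover have "w \<ge> 0" using c0 by (simp add: w_def)
      ultimately have "w^DIM('a) < 1" using power_decreasing[of 1 "DIM('a)" w] assms(1) by simp
      then show False using rn(2) cd0 wd by (simp add: field_simps)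
    qed
    have wK: "w \<le> K * w" "2 * w \<le> K * w" using K2 \<open>w \<ge> 1\<close> by auto
    have Kw1: "1 \<le> K * w" using wK \<open>w \<ge> 1\<close> by linarith
    define E0 where "E0 = pair_edges k t w 0 S"
    assume "\<not> good_pairs k t (c * real (card S) powr (1 / real DIM('a))) S \<le> turan (card S) a"
    then have many0: "card E0 > turan n a"
      unfolding n_def[symmetric] w_def[symmetric] good_pairs_eq E0_def[symmetric] by simp
    have pown: "real n ^ a = real n ^ (a - 1) * real n" "real n ^ (a - 1) = real n ^ (a - 2) * real n"
      using a2 power_Suc2[of "real n" "a - 1"] power_Suc2[of "real n" "a - 2"]
      by (simp_all add: Suc_diff_Suc numeral_2_eq_2)
    have "\<exists>P::'a set. finite P \<and> card P = Suc a \<and> almost_flat (DIM('a) - 1) \<alpha> P \<and> nearly_k_distance k \<epsilon> P"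
    proof (cases "t 0 < K * w")
      case False
      have ti: "K * w \<le> t i" if "i < k" for i
        using that
      proof (induction i)
        case (Suc i)
        then show ?case using S(4) unfolding dist_params_def by (metis Suc_lessD order_trans)
      qed (use False in simp)
      obtain p q where pq: "p \<in> S" "q \<in> S" "p \<noteq> q"
        and count: "\<delta>B * real n^(a - 1) \<le> real (card {C \<in> cliques E0 S (Suc a). {p, q} \<subseteq> C})"
        using edgeB[of E0 S] S(2) nbig(2) many0
        unfolding E0_def edges_in_pair_edges n_def[symmetric] by (meson simple_pair_edges)
      define \<C> where "\<C> = {C \<in> cliques E0 S (Suc a). {p, q} \<subseteq> C}"
      have ed: "0 < dist x y \<and> (\<exists>i<k. t i \<le> dist x y \<and> dist x y \<le> t i + w)"
        if "C \<in> \<C>" "x \<in> C" "y \<in> C" "x \<noteq> y" for C x y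
        using that pair_edgesD[of x y k t w 0 S] by (auto simp: \<C>_def cliques_def clique_def E0_def)
      have "\<exists>C\<in>\<C>. \<forall>v\<in>C-{p, q}. \<exists>v'\<in>S. companion k t w K (C - {v}) v v'"
      proof (rule good_clique_exists[where m = "Suc a"])
        show "card {p, q} < Suc a" using a2 pq by simp
        show "2 * w \<le> dist x y \<and> (\<exists>i<k. t i \<le> dist x y \<and> dist x y \<le> t i + w)"
          if C: "C \<in> \<C>" "x \<in> C" "y \<in> C" "x \<noteq> y" for C x y
        proof -
          obtain i where "i < k" "t i \<le> dist x y" using ed[OF C] by blast
          then have "2 * w \<le> dist x y" using ti[of i] wK by linarith
          then show ?thesis using ed[OF C] by blast
        qed
        \<comment> \<open>With the edge \<open>{p, q}\<close> fixed, \<open>a - 2\<close> vertices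
          of \<open>D\<close> are free; the last vertex contributes a factor linear in
          \<open>n\<close>.\<close>
        have "real n ^ (a - 2) * (fB * w^DIM('a)) = fB * cd * real n ^ (a - 1)"
          unfolding wd pown(2) by simp
        also have "\<dots> < \<delta>B * real n ^ (a - 1)" using ltB rn(1) by simp
        finally show "real (card S) ^ (Suc a - 1 - card {p, q}) *
            (fiber_bound TYPE('a) k (Suc a - 1) K * w^DIM('a)) < real (card \<C>)"
          using count pq(3) by (simp add: n_def \<C>_def fB_def numeral_2_eq_2)
      qed (use S pq a2 \<open>w \<ge> 1\<close> K1 assms in \<open>auto simp: \<C>_def cliques_def\<close>)
      then obtain C where C: "C \<in> \<C>"
        and comp: "\<And>v. v \<in> C - {p, q} \<Longrightarrow> \<exists>v'. companion k t w K (C - {v}) v v'" by blast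
      have CS: "finite C" "card C = Suc a" "{p, q} \<subseteq> C"
        using C S(2) finite_subset by (auto simp: \<C>_def cliques_def)
      have "\<exists>P::'a set. finite P \<and> card P = card C \<and> almost_flat (DIM('a) - 1) \<alpha> P \<and> nearly_k_distance k \<epsilon> P"
        using ed[OF C] pq(3) \<open>w \<ge> 1\<close>
        by (intro flat_set_of_clique[OF assms CS(1,3) _ ea(1) \<beta> _ K1 Keps K2' ti _ comp]) auto
      then show ?thesis using CS(2) by simp
    next
      case True
      define E1 where "E1 = pair_edges k t w (2 * (K * w)) S"
      \<comment> \<open>Half of the gap \<open>\<rho> * n^2\<close> is left after the short edges
        are removed, and rounding down keeps at least a quarter of the gap.\<close>
      define x where "x = nat \<lfloor>\<rho> / 2 * (real n)^2\<rfloor>"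
      have n2: "(real n)^2 * \<rho> \<ge> 4"
      proof -
        have "real n * \<rho> \<ge> 4" using rn(3) \<rho> by (simp add: field_simps)
        moreover have "real n * (real n * \<rho>) \<ge> 1 * (real n * \<rho>)" using rn(1) \<rho> by (intro mult_right_mono) auto
        ultimately show ?thesis by (simp add: power2_eq_square mult.assoc)
      qed
      then have "\<rho> / 2 * (real n)^2 \<ge> 0" by (simp add: mult.commute)
      then have xle: "real x \<le> \<rho> / 2 * (real n)^2" and "real x \<ge> \<rho> / 2 * (real n)^2 - 1"
        unfolding x_def by linarith+
      then have xge: "real x \<ge> \<rho> / 4 * (real n)^2" using n2 by (simp add: mult.commute)
      have "(2 * (2 * (K * w)) * DIM('a) + 2)^DIM('a) \<le> ((4 * real DIM('a) + 2) * K * w)^DIM('a)"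
      proof (intro power_mono)
        show "0 \<le> 2 * (2 * (K * w)) * real DIM('a) + 2" using K1 \<open>w \<ge> 1\<close> by simp
      qed (use Kw1 in \<open>simp add: algebra_simps\<close>)
      also have "\<dots> = h * cd * real n" by (simp add: h_def wd power_mult_distrib)
      also have "\<dots> \<le> \<rho> / 2 * real n" using lth by (intro mult_right_mono) auto
      finally have "real n * (2 * (2 * (K * w)) * DIM('a) + 2)^DIM('a) \<le> real n * (\<rho> / 2 * real n)"
        by (rule mult_left_mono) simp
      moreover have "real (card E0) \<le> real (card E1) + real n * (2 * (2 * (K * w)) * DIM('a) + 2)^DIM('a)"
        using card_short_pairs[OF S(1,2), of "2 * (K * w)" k t w] wK \<open>w \<ge> 1\<close>
        by (simp add: E0_def E1_def n_def)
      ultimately have "real (card E0) \<le> real (card E1) + real n * (\<rho> / 2 * real n)" by linarith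
      then have "real (turan n a) \<le> real (card E1) + \<rho> / 2 * (real n)^2"
        using many0 by (simp add: power2_eq_square mult_ac)
      moreover have "real (turan n (a - 1)) + \<rho> * (real n)^2 \<le> real (turan n a)"
        using turan_gap[OF a1, of n] nbig(3) a2 by (simp add: \<rho>_def Suca)
      ultimately have "real (turan n (a - 1)) + real x \<le> real (card E1)" using xle by argo
      then have "turan n (a - 1) + x \<le> card E1" by (simp flip: of_nat_add)
      then have "real x * \<delta>A * real n ^ (a - 2) \<le> real (card (cliques E1 S a))"
        using manyA[of E1 S x] S(2) nbig(1)
        by (simp add: E1_def edges_in_pair_edges simple_pair_edges n_def numeral_2_eq_2)
      moreover have "\<rho> / 4 * (real n)^2 * (\<delta>A * real n ^ (a - 2)) \<le> real x * (\<delta>A * real n ^ (a - 2))"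
        using xge dA by (intro mult_right_mono) auto
      ultimately have count: "\<rho> / 4 * \<delta>A * real n ^ a \<le> real (card (cliques E1 S a))"
        unfolding pown power2_eq_square by (simp add: mult_ac)
      have ed: "2 * (K * w) < dist x y \<and> (\<exists>i<k. t i \<le> dist x y \<and> dist x y \<le> t i + w)"
        if "C \<in> cliques E1 S a" "x \<in> C" "y \<in> C" "x \<noteq> y" for C x y
        using that pair_edgesD[of x y k t w "2 * (K * w)" S] by (auto simp: cliques_def clique_def E1_def)
      have "\<exists>C\<in>cliques E1 S a. \<forall>v\<in>C-{}. \<exists>v'\<in>S. companion k t w K (C - {v}) v v'"
      proof (rule good_clique_exists[where m = a])
        show "2 * w \<le> dist x y \<and> (\<exists>i<k. t i \<le> dist x y \<and> dist x y \<le> t i + w)"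
          if C: "C \<in> cliques E1 S a" "x \<in> C" "y \<in> C" "x \<noteq> y" for C x y
        proof
          show "2 * w \<le> dist x y" using conjunct1[OF ed[OF C]] wK Kw1 by linarith
        qed (use ed[OF C] in blast)
        have "real n ^ (a - 1) * (fA * w^DIM('a)) = fA * cd * real n ^ a"
          unfolding wd pown(1) by simp
        also have "\<dots> < \<rho> / 4 * \<delta>A * real n ^ a" using ltA rn(1) by simp
        finally show "real (card S) ^ (a - 1 - card {}) *
            (fiber_bound TYPE('a) k (a - 1) K * w^DIM('a)) < real (card (cliques E1 S a))"
          using count by (simp add: n_def fA_def)
      qed (use S a2 \<open>w \<ge> 1\<close> K1 assms in \<open>auto simp: cliques_def\<close>)
      then obtain C where C: "C \<in> cliques E1 S a"
        and comp: "\<And>v. v \<in> C \<Longrightarrow> \<exists>v'. companion k t w K (C - {v}) v v'" by blast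
      have CS: "finite C" "card C = a" "C \<noteq> {}"
        using C S(2) finite_subset a2 by (auto simp: cliques_def)
      have "\<exists>P::'a set. finite P \<and> card P = Suc (card C) \<and> almost_flat (DIM('a) - 1) \<alpha> P \<and> nearly_k_distance k \<epsilon> P"
        using ed[OF C] \<open>w \<ge> 1\<close>
        by (intro flat_set_of_clique_and_companion[OF assms CS(1,3) ea(1) \<beta> _ K2 Keps K6 True _ comp]) auto
      then show ?thesis using CS(2) by simp
    qed
    then show False using none by blast
  qed
  then show ?thesis using c0 unfolding a_def by blast
qed

section \<open>Transfer to the maximum over all configurations\<close>

text \<open>To use the \<open>GREATEST\<close> in \<open>Mw\<close>, some value must qualify.
  Equally spaced points on a line show that \<open>n\<close> separated points exist, so 0
  does.\<close>

lemma Mw_le: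
  assumes "\<And>(S::'a::euclidean_space set) t. separated S \<Longrightarrow> finite S \<Longrightarrow> card S = n \<Longrightarrow> dist_params k t \<Longrightarrow>
      good_pairs k t w S \<le> B"
  shows "Mw TYPE('a) k n w \<le> B"
proof -
  define Q where "Q m \<longleftrightarrow> (\<exists>(S::'a set) t. separated S \<and> finite S \<and> card S = n \<and>
       dist_params k t \<and> m \<le> good_pairs k t w S)" for m
  have bound: "m \<le> B" if "Q m" for m using that assms order_trans unfolding Q_def by blast
  obtain b :: 'a where b: "b \<in> Basis" using SOME_Basis by blast
  define f where "f i = real i *\<^sub>R b" for i
  have df: "dist (f i) (f j) = \<bar>real i - real j\<bar>" for i j
    using b by (simp add: f_def dist_norm flip: scaleR_diff_left)
  have "1 \<le> dist (f i) (f j)" if "f i \<noteq> f j" for i j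
  proof -
    have "i \<noteq> j" using that by auto
    then show ?thesis by (simp add: df)
  qed
  then have "separated (f ` {..<n})" unfolding separated_def by blast
  moreover have "inj_on f {..<n}"
    by (rule inj_onI) (metis df dist_self abs_0_eq eq_iff_diff_eq_0 of_nat_eq_iff)
  then have "card (f ` {..<n}) = n" by (simp add: card_image)
  moreover have "dist_params k (\<lambda>_. 1)" by (simp add: dist_params_def)
  ultimately have "Q 0" unfolding Q_def by blast
  then have "Q (Greatest Q)" using bound by (rule GreatestI_nat)
  then show ?thesis using bound unfolding Mw_def Q_def[abs_def] by blast
qed

theorem theorem11:
  fixes k :: nat
  assumes "DIM('a::euclidean_space) \<ge> 2" and "k \<ge> 1"
  shows "(\<exists>n0. \<forall>n\<ge>n0.
            M TYPE('a) k n \<le> turan n (A TYPE('a) k) \<and>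
            real (turan n (A TYPE('a) k)) \<le> (1 - 1 / real (A TYPE('a) k)) * real n ^ 2 / 2)
       \<and> (\<exists>c>0. \<exists>n0. \<forall>n\<ge>n0.
            Mw TYPE('a) k n (c * real n powr (1 / real DIM('a))) \<le> turan n (A TYPE('a) k) \<and>
            real (turan n (A TYPE('a) k)) \<le> (1 - 1 / real (A TYPE('a) k)) * real n ^ 2 / 2)"
proof -
  have "A TYPE('a) k > 0" using A_maximal(1)[OF assms(2), where 'a = 'a] by simp
  then have upper: "real (turan n (A TYPE('a) k)) \<le> (1 - 1 / real (A TYPE('a) k)) * real n ^ 2 / 2" for n
    by (rule turan_upper)
  obtain c n0 where c: "c > 0" and main:
    "\<And>(S::'a set) t. separated S \<Longrightarrow> finite S \<Longrightarrow> n0 \<le> card S \<Longrightarrow> dist_params k t \<Longrightarrow>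
     good_pairs k t (c * real (card S) powr (1 / real DIM('a))) S \<le> turan (card S) (A TYPE('a) k)"
    using good_pairs_le_turan[OF assms] by blast
  have wide: "Mw TYPE('a) k n (c * real n powr (1 / real DIM('a))) \<le> turan n (A TYPE('a) k)" if "n0 \<le> n" for n
    using main that by (intro Mw_le) auto
  \<comment> \<open>Once \<open>n\<close> is at least \<open>(1 / c) ^ DIM('a)\<close>, the wide
    intervals have width at least 1, so the bound for width 1 follows by monotonicity.\<close>
  have "Mw TYPE('a) k n 1 \<le> turan n (A TYPE('a) k)" if n: "max n0 (nat \<lceil>(1 / c) ^ DIM('a)\<rceil>) \<le> n" for n
  proof (rule Mw_le)
    fix S :: "'a set" and t
    assume S: "separated S" "finite S" "card S = n" "dist_params k t"
    have "(1 / c) ^ DIM('a) \<le> real n" using n by linarith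
    then have "((1 / c) ^ DIM('a)) powr (1 / real DIM('a)) \<le> real n powr (1 / real DIM('a))"
      using c by (intro powr_mono2) auto
    moreover have "((1 / c) ^ DIM('a)) powr (1 / real DIM('a)) = 1 / c"
      using c by (simp add: powr_powr flip: powr_realpow)
    ultimately have "1 / c \<le> real n powr (1 / real DIM('a))" by simp
    then have "1 \<le> c * real n powr (1 / real DIM('a))" using c by (simp add: divide_le_eq mult.commute)
    then have "good_pairs k t 1 S \<le> good_pairs k t (c * real n powr (1 / real DIM('a))) S"
      by (rule good_pairs_mono[OF S(2)])
    also have "\<dots> \<le> turan n (A TYPE('a) k)" using main[OF S(1,2) _ S(4)] S(3) n by simp
    finally show "good_pairs k t 1 S \<le> turan n (A TYPE('a) k)" .
  qed
  then show ?thesis using c wide upper by blast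
qed

end
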